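(* Let $G_1,G_2,G_3$ be non-discrete, compactly generated, quasi just-non-compact tdlc groups. Let $\Gamma \leq G_1 \times G_2 \times G_3$ be a cocompact lattice such that $p_i \colon \Gamma \rightarrow G_i$ has dense image for $i=1,2,3$. Then $\Gamma$ satisfies the (equivalent) conditions (Irr0), (Irr1$'$) and (Irr3).
   Context: "tdlc" means totally disconnected locally compact (Hausdorff topological group). A locally compact group is quasi just-non-compact if it is non-compact and every closed normal subgroup is discrete or cocompact. Put $n=3$ and $G=G_1\times G_2\times G_3$. For $\Sigma \subseteq \{1,\ldots,n\}$, $G_\Sigma = \prod_{j \in \Sigma} G_j$, identified with its natural image in $G$, and $p_\Sigma \colon G \to G_\Sigma$ is the projection; $p_i = p_{\{i\}}$. The conditions are: (Irr0) For every partition $\Pi \cup \Sigma = \{1,\ldots,n\}$ with $\Pi, \Sigma \neq \varnothing$, the subgroup $(G_\Pi \cap \Gamma)(G_\Sigma \cap \Gamma)$ is of infinite index in $\Gamma$. (Irr1$'$) For every $\Sigma \subsetneq \{1,\ldots,n\}$, the closure of the image of $p_\Sigma \colon \Gamma \to G_\Sigma$ contains $\prod_{i \in \Sigma} G^+_i$, where each $G^+_i$ is some non-discrete closed cocompact normal subgroup of $G_i$. (Irr3) For every non-empty $\Sigma \subsetneq \{1,\ldots,n\}$, the projection $p_\Sigma \colon \Gamma \to G_\Sigma$ has a non-discrete image. *)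

theory Defs
  imports "HOL-Analysis.Analysis" "HOL-Algebra.Product_Groups"
begin

no_notation eq_closure_of (\<open>closure'_of\<index>\<close>)

subsection \<open>Topological groups\<close>

locale topological_group = group G for G (structure) and T :: "'a topology" +
  assumes topspace_eq: "topspace T = carrier G"
    and continuous_mult: "continuous_map (prod_topology T T) T (\<lambda>(x, y). x \<otimes> y)"
    and continuous_inv: "continuous_map T T (\<lambda>x. inv x)"

definition totally_disconnected_space :: "'a topology \<Rightarrow> bool" where
  "totally_disconnected_space T \<longleftrightarrow>
    (\<forall>x \<in> topspace T. connected_component_of_set T x = {x})"

locale tdlc_group = topological_group +
  assumes Hausdorff: "Hausdorff_space T"
    and totally_disconnected: "totally_disconnected_space T"
    and locally_compact: "locally_compact_space T"

definition compactly_generated :: "('a, 'b) monoid_scheme \<Rightarrow> 'a topology \<Rightarrow> bool" where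
  "compactly_generated G T \<longleftrightarrow> (\<exists>K. compactin T K \<and> generate G K = carrier G)"

text \<open>Only used for subsets \<open>S\<close> of \<open>topspace T\<close>: the subspace topology on \<open>S\<close> is discrete.
  This does not require \<open>S\<close> to be closed.\<close>

definition discrete_in :: "'a topology \<Rightarrow> 'a set \<Rightarrow> bool" where
  "discrete_in T S \<longleftrightarrow> subtopology T S = discrete_topology S"

definition quotient_topology :: "'a topology \<Rightarrow> ('a \<Rightarrow> 'b) \<Rightarrow> 'b topology" where
  "quotient_topology T f =
    topology (\<lambda>V. V \<subseteq> f ` topspace T \<and> openin T {x \<in> topspace T. f x \<in> V})"

lemma openin_quotient_topology:
  "openin (quotient_topology T f) V \<longleftrightarrow>
    V \<subseteq> f ` topspace T \<and> openin T {x \<in> topspace T. f x \<in> V}"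
proof -
  have "istopology (\<lambda>V. V \<subseteq> f ` topspace T \<and> openin T {x \<in> topspace T. f x \<in> V})"
    unfolding istopology_def
  proof (intro conjI allI impI)
    fix A B
    assume A: "A \<subseteq> f ` topspace T \<and> openin T {x \<in> topspace T. f x \<in> A}"
      and B: "B \<subseteq> f ` topspace T \<and> openin T {x \<in> topspace T. f x \<in> B}"
    show "A \<inter> B \<subseteq> f ` topspace T"
      using A by blast
    have "{x \<in> topspace T. f x \<in> A \<inter> B} =
        {x \<in> topspace T. f x \<in> A} \<inter> {x \<in> topspace T. f x \<in> B}"
      by blast
    then show "openin T {x \<in> topspace T. f x \<in> A \<inter> B}"
      using openin_Int[OF conjunct2[OF A] conjunct2[OF B]] by (simp only:)
  next
    fix \<K>
    assume K: "\<forall>K\<in>\<K>. K \<subseteq> f ` topspace T \<and> openin T {x \<in> topspace T. f x \<in> K}"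
    show "\<Union>\<K> \<subseteq> f ` topspace T"
      using K by blast
    have "{x \<in> topspace T. f x \<in> \<Union>\<K>} = (\<Union>K\<in>\<K>. {x \<in> topspace T. f x \<in> K})"
      by blast
    moreover have "openin T (\<Union>K\<in>\<K>. {x \<in> topspace T. f x \<in> K})"
      using K by (intro openin_Union) blast
    ultimately show "openin T {x \<in> topspace T. f x \<in> \<Union>\<K>}"
      by (simp only:)
  qed
  then show ?thesis
    unfolding quotient_topology_def by (rule topology_inverse'[THEN fun_cong])
qed

lemma topspace_quotient_topology [simp]:
  "topspace (quotient_topology T f) = f ` topspace T"
proof
  show "topspace (quotient_topology T f) \<subseteq> f ` topspace T"
    using openin_topspace[of "quotient_topology T f", unfolded openin_quotient_topology]
    by (rule conjunct1)
  have "{x \<in> topspace T. f x \<in> f ` topspace T} = topspace T"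
    by blast
  then have "openin (quotient_topology T f) (f ` topspace T)"
    by (simp add: openin_quotient_topology)
  then show "f ` topspace T \<subseteq> topspace (quotient_topology T f)"
    by (rule openin_subset)
qed

lemma quotient_map_quotient_topology: "quotient_map T (quotient_topology T f) f"
  by (auto simp: quotient_map_def openin_quotient_topology)

text \<open>The space \<open>G/H\<close> of cosets \<open>gH\<close>, with the quotient topology, is compact.\<close>

definition cocompact :: "('a, 'b) monoid_scheme \<Rightarrow> 'a topology \<Rightarrow> 'a set \<Rightarrow> bool" where
  "cocompact G T H \<longleftrightarrow> compact_space (quotient_topology T (\<lambda>g. g <#\<^bsub>G\<^esub> H))"

definition quasi_just_non_compact :: "('a, 'b) monoid_scheme \<Rightarrow> 'a topology \<Rightarrow> bool" where
  "quasi_just_non_compact G T \<longleftrightarrow>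
    \<not> compact_space T \<and>
    (\<forall>N. normal N G \<and> closedin T N \<longrightarrow> discrete_in T N \<or> cocompact G T N)"

text \<open>A cocompact (uniform) lattice is a discrete subgroup with compact quotient. For a
  discrete subgroup of a locally compact group, compactness of the quotient already implies that
  it carries a finite invariant measure.\<close>

definition cocompact_lattice :: "('a, 'b) monoid_scheme \<Rightarrow> 'a topology \<Rightarrow> 'a set \<Rightarrow> bool" where
  "cocompact_lattice G T \<Gamma> \<longleftrightarrow> subgroup \<Gamma> G \<and> discrete_in T \<Gamma> \<and> cocompact G T \<Gamma>"

subsection \<open>Irreducibility conditions for subgroups of a product\<close>

text \<open>
  The product of the \<open>G i\<close>, \<open>i \<in> I\<close>, is \<open>product_group I G\<close> with \<open>product_topology T I\<close>; its
  elements are functions that are \<open>undefined\<close> outside \<open>I\<close>. Having all \<open>G i\<close> over one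
  type is no restriction, as the carriers are arbitrary sets and any three types embed in their sum.
\<close>

abbreviation proj :: "'i set \<Rightarrow> ('i \<Rightarrow> 'a) \<Rightarrow> 'i \<Rightarrow> 'a" where
  "proj \<Sigma> x \<equiv> restrict x \<Sigma>"

text \<open>The natural image in \<open>product_group I G\<close> of the partial product over \<open>\<Sigma>\<close>.\<close>

definition subproduct :: "'i set \<Rightarrow> ('i \<Rightarrow> 'a monoid) \<Rightarrow> 'i set \<Rightarrow> ('i \<Rightarrow> 'a) set" where
  "subproduct I G \<Sigma> =
    {x \<in> carrier (product_group I G). \<forall>i \<in> I - \<Sigma>. x i = \<one>\<^bsub>G i\<^esub>}"

definition infinite_index :: "('a, 'b) monoid_scheme \<Rightarrow> 'a set \<Rightarrow> 'a set \<Rightarrow> bool" where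
  "infinite_index G K H \<longleftrightarrow> infinite (rcosets\<^bsub>G\<lparr>carrier := K\<rparr>\<^esub> H)"

definition Irr0 :: "'i set \<Rightarrow> ('i \<Rightarrow> 'a monoid) \<Rightarrow> ('i \<Rightarrow> 'a) set \<Rightarrow> bool" where
  "Irr0 I G \<Gamma> \<longleftrightarrow>
    (\<forall>\<Sigma>' \<Sigma>. \<Sigma>' \<union> \<Sigma> = I \<and> \<Sigma>' \<inter> \<Sigma> = {} \<and> \<Sigma>' \<noteq> {} \<and> \<Sigma> \<noteq> {} \<longrightarrow>
      infinite_index (product_group I G) \<Gamma>
        ((subproduct I G \<Sigma>' \<inter> \<Gamma>) <#>\<^bsub>product_group I G\<^esub> (subproduct I G \<Sigma> \<inter> \<Gamma>)))"

text \<open>The subgroups \<open>P i\<close> (written \<open>G\<^sub>i\<^sup>+\<close> on paper) are chosen once and for all,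
  independently of \<open>\<Sigma>\<close>.\<close>

definition Irr1' ::
  "'i set \<Rightarrow> ('i \<Rightarrow> 'a monoid) \<Rightarrow> ('i \<Rightarrow> 'a topology) \<Rightarrow> ('i \<Rightarrow> 'a) set \<Rightarrow> bool" where
  "Irr1' I G T \<Gamma> \<longleftrightarrow>
    (\<exists>P. (\<forall>i \<in> I. normal (P i) (G i) \<and> closedin (T i) (P i) \<and> cocompact (G i) (T i) (P i) \<and>
            \<not> discrete_in (T i) (P i)) \<and>
      (\<forall>\<Sigma>. \<Sigma> \<subset> I \<longrightarrow> PiE \<Sigma> P \<subseteq> product_topology T \<Sigma> closure_of (proj \<Sigma> ` \<Gamma>)))"

definition Irr3 :: "'i set \<Rightarrow> ('i \<Rightarrow> 'a topology) \<Rightarrow> ('i \<Rightarrow> 'a) set \<Rightarrow> bool" where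
  "Irr3 I T \<Gamma> \<longleftrightarrow>
    (\<forall>\<Sigma>. \<Sigma> \<noteq> {} \<and> \<Sigma> \<subset> I \<longrightarrow>
      \<not> discrete_in (product_topology T \<Sigma>) (proj \<Sigma> ` \<Gamma>))"

end

theory Submission
  imports Defs "HOL-Algebra.Zassenhaus"
begin

text \<open>
  Fix \<open>i \<noteq> j\<close>, let \<open>k\<close> be the third index, and let \<open>H \<le> G\<^sub>i \<times> G\<^sub>j\<close> be the closure of the projection of
  \<open>\<Gamma>\<close>. Two facts about a non-discrete compactly generated quasi just-non-compact tdlc group \<open>X\<close> are
  used. First, if \<open>A\<close> and \<open>B\<close> are closed normal subgroups with \<open>A\<close> cocompact and \<open>B\<close> non-discrete,
  then \<open>A \<inter> B\<close> is non-discrete: otherwise a small compact open subgroup of \<open>B\<close> centralises \<open>A\<close>, and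
  its conjugates generate a compact non-discrete normal subgroup. In particular (\<open>B = X\<close>) no
  cocompact normal subgroup is discrete. Second, if \<open>H \<le> X \<times> Y\<close> is closed, cocompact and
  non-discrete, with dense projections, then \<open>H \<inter> X\<close> is non-discrete.

  If the projection of \<open>\<Gamma>\<close> to \<open>G\<^sub>i \<times> G\<^sub>j\<close> were discrete, \<open>\<Gamma> \<inter> G\<^sub>k\<close> would be a discrete cocompact normal
  subgroup of \<open>G\<^sub>k\<close>; this gives (Irr3). Hence \<open>H\<close> is non-discrete, so \<open>H \<inter> G\<^sub>i\<close> is a non-discrete,
  and therefore cocompact, normal subgroup of \<open>G\<^sub>i\<close>. The intersection of the two subgroups obtained
  from \<open>j\<close> and from \<open>k\<close> is the group \<open>G\<^sub>i\<^sup>+\<close> of (Irr1'). For (Irr0), one side of the partition is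
  a singleton \<open>{k}\<close>, and finite index would cover the dense image of \<open>\<Gamma>\<close> in \<open>G\<^sub>k\<close> by finitely many
  cosets of the discrete subgroup \<open>\<Gamma> \<inter> G\<^sub>k\<close>.
\<close>

no_notation (input) subset_mset  (infix \<open><#\<close> 50)

subsection \<open>Topological groups\<close>

context topological_group
begin

lemma open_subset_carrier: "openin T U \<Longrightarrow> U \<subseteq> carrier G"
  using openin_subset topspace_eq by blast

lemma closed_subset_carrier: "closedin T U \<Longrightarrow> U \<subseteq> carrier G"
  using closedin_subset topspace_eq by blast

lemma compact_subset_carrier: "compactin T K \<Longrightarrow> K \<subseteq> carrier G"
  using compactin_subset_topspace topspace_eq by blast

lemma continuous_map_group_mult:
  assumes "continuous_map Z T f" "continuous_map Z T g"
  shows "continuous_map Z T (\<lambda>z. f z \<otimes> g z)"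
proof -
  have "continuous_map Z (prod_topology T T) (\<lambda>z. (f z, g z))"
    using assms by (simp add: continuous_map_pairedI)
  from continuous_map_compose[OF this continuous_mult] show ?thesis
    by (simp add: o_def)
qed

lemma continuous_map_group_inv:
  assumes "continuous_map Z T f"
  shows "continuous_map Z T (\<lambda>z. inv (f z))"
  using continuous_map_compose[OF assms continuous_inv] by (simp add: o_def)

lemma continuous_map_const_carrier:
  "a \<in> carrier G \<Longrightarrow> continuous_map Z T (\<lambda>z. a)"
  by (simp add: topspace_eq)

lemmas continuous_map_group_intros =
  continuous_map_group_mult continuous_map_group_inv continuous_map_const_carrier
  continuous_map_fst continuous_map_snd continuous_map_id[unfolded id_def]

lemma continuous_map_conj: "a \<in> carrier G \<Longrightarrow> continuous_map T T (\<lambda>x. a \<otimes> x \<otimes> inv a)"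
  by (intro continuous_map_group_intros) auto

section \<open>Translations and cosets\<close>

lemma open_vimage_l_mult:
  assumes "openin T U" "a \<in> carrier G"
  shows "openin T {x \<in> carrier G. a \<otimes> x \<in> U}"
  using openin_continuous_map_preimage[OF
      continuous_map_group_mult[OF continuous_map_const_carrier[OF assms(2)] continuous_map_id[unfolded id_def]] assms(1)]
  by (simp add: topspace_eq)

lemma open_vimage_r_mult:
  assumes "openin T U" "a \<in> carrier G"
  shows "openin T {x \<in> carrier G. x \<otimes> a \<in> U}"
  using openin_continuous_map_preimage[OF
      continuous_map_group_mult[OF continuous_map_id[unfolded id_def] continuous_map_const_carrier[OF assms(2)]] assms(1)]
  by (simp add: topspace_eq)

lemma l_coset_eq_vimage:
  assumes "S \<subseteq> carrier G" "a \<in> carrier G"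
  shows "a <# S = {x \<in> carrier G. inv a \<otimes> x \<in> S}"
proof (intro equalityI subsetI)
  fix x assume "x \<in> {x \<in> carrier G. inv a \<otimes> x \<in> S}"
  then have "inv a \<otimes> x \<in> S" "x = a \<otimes> (inv a \<otimes> x)"
    using assms by (auto simp: m_assoc[symmetric])
  then show "x \<in> a <# S"
    unfolding l_coset_def by blast
qed (use assms in \<open>auto simp: l_coset_def m_assoc[symmetric] subset_iff\<close>)

lemma r_coset_eq_vimage:
  assumes "S \<subseteq> carrier G" "a \<in> carrier G"
  shows "S #> a = {x \<in> carrier G. x \<otimes> inv a \<in> S}"
proof (intro equalityI subsetI)
  fix x assume "x \<in> {x \<in> carrier G. x \<otimes> inv a \<in> S}"
  then have "x \<otimes> inv a \<in> S" "x = x \<otimes> inv a \<otimes> a"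
    using assms by (auto simp: m_assoc)
  then show "x \<in> S #> a"
    unfolding r_coset_def by blast
qed (use assms in \<open>auto simp: r_coset_def m_assoc subset_iff\<close>)

lemma mem_l_coset_self: "\<one> \<in> S \<Longrightarrow> a \<in> carrier G \<Longrightarrow> a \<in> a <# S"
  unfolding l_coset_def using r_one[of a] by blast

lemma mem_r_coset_self: "\<one> \<in> S \<Longrightarrow> a \<in> carrier G \<Longrightarrow> a \<in> S #> a"
  unfolding r_coset_def using l_one[of a] by blast

lemma open_l_coset: "openin T U \<Longrightarrow> a \<in> carrier G \<Longrightarrow> openin T (a <# U)"
  using l_coset_eq_vimage open_vimage_l_mult open_subset_carrier by simp

lemma open_r_coset: "openin T U \<Longrightarrow> a \<in> carrier G \<Longrightarrow> openin T (U #> a)"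
  using r_coset_eq_vimage open_vimage_r_mult open_subset_carrier by simp

lemma closed_l_coset:
  assumes "closedin T U" "a \<in> carrier G"
  shows "closedin T (a <# U)"
proof -
  have "a <# U = {x \<in> topspace T. inv a \<otimes> x \<in> U}"
    unfolding topspace_eq using assms(2) closed_subset_carrier[OF assms(1)] by (rule l_coset_eq_vimage[rotated])
  moreover have "continuous_map T T (\<lambda>x. inv a \<otimes> x)"
    using assms by (intro continuous_map_group_intros) auto
  ultimately show ?thesis
    using assms(1) by (simp add: closedin_continuous_map_preimage)
qed

lemma compact_set_mult:
  assumes "compactin T K" "compactin T L"
  shows "compactin T (K <#> L)"
proof -
  have "K <#> L = (\<lambda>(x, y). x \<otimes> y) ` (K \<times> L)"
    by (auto simp: set_mult_def)
  then show ?thesis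
    using image_compactin[OF iffD2[OF compactin_Times] continuous_mult, of K L] assms
    by (simp only: simp_thms)
qed

lemma compact_set_inv:
  assumes "compactin T K"
  shows "compactin T (set_inv K)"
proof -
  have "set_inv K = (\<lambda>x. inv x) ` K"
    by (auto simp: SET_INV_def)
  then show ?thesis
    using image_compactin[OF assms continuous_inv] by (simp only:)
qed

lemma compact_l_coset:
  assumes "compactin T K" "a \<in> carrier G"
  shows "compactin T (a <# K)"
  using compact_set_mult[of "{a}" K] assms by (simp add: l_coset_eq_set_mult topspace_eq)

section \<open>Open subgroups, closures of subgroups and normalisers\<close>

lemma subgroup_openin:
  assumes S: "subgroup S G" and U: "openin T U" "\<one> \<in> U" "U \<subseteq> S"
  shows "openin T S"
proof (subst openin_subopen, intro ballI)
  fix s assume s: "s \<in> S"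
  have sc: "s \<in> carrier G"
    by (rule subgroup.mem_carrier[OF S s])
  have "s <# U \<subseteq> S"
  proof
    fix x assume "x \<in> s <# U"
    then obtain u where "u \<in> U" "x = s \<otimes> u"
      unfolding l_coset_def by blast
    then show "x \<in> S"
      using U(3) subgroup.m_closed[OF S s] by blast
  qed
  moreover have "s \<in> s <# U"
    using U(2) sc by (rule mem_l_coset_self)
  ultimately show "\<exists>W. openin T W \<and> s \<in> W \<and> W \<subseteq> S"
    using open_l_coset[OF U(1) sc] by (intro exI[of _ "s <# U"] conjI)
qed

lemma open_subgroup_closed:
  assumes S: "subgroup S G" and o: "openin T S"
  shows "closedin T S"
proof -
  have "topspace T - S = (\<Union>a\<in>carrier G - S. a <# S)"
  proof (intro equalityI subsetI)
    fix x assume "x \<in> topspace T - S"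
    then show "x \<in> (\<Union>a\<in>carrier G - S. a <# S)"
      using mem_l_coset_self[OF subgroup.one_closed[OF S]] topspace_eq by blast
  next
    fix x assume "x \<in> (\<Union>a\<in>carrier G - S. a <# S)"
    then obtain a s where as: "a \<in> carrier G" "a \<notin> S" "s \<in> S" "x = a \<otimes> s"
      by (auto simp: l_coset_def)
    have sc: "s \<in> carrier G"
      using as(3) by (rule subgroup.mem_carrier[OF S])
    have "x \<notin> S"
    proof
      assume "x \<in> S"
      then have "x \<otimes> inv s \<in> S"
        using as S by (simp add: subgroup.m_closed subgroup.m_inv_closed)
      then show False
        using as sc by (simp add: m_assoc)
    qed
    then show "x \<in> topspace T - S"
      using as sc by (simp add: topspace_eq)
  qed
  moreover have "openin T (\<Union>a\<in>carrier G - S. a <# S)"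
    using open_l_coset o by (intro openin_Union) auto
  ultimately show ?thesis
    using open_subset_carrier[OF o] by (simp add: closedin_def topspace_eq)
qed

lemma subgroup_closure_of:
  assumes S: "subgroup S G"
  shows "subgroup (T closure_of S) G"
proof -
  have sub: "S \<subseteq> T closure_of S"
    using S by (intro closure_of_subset) (simp add: topspace_eq subgroup.subset)
  show ?thesis
  proof (rule subgroupI)
    show "T closure_of S \<subseteq> carrier G"
      using closure_of_subset_topspace topspace_eq by metis
    show "T closure_of S \<noteq> {}"
      using sub subgroup.one_closed[OF S] by blast
    show "inv a \<in> T closure_of S" if "a \<in> T closure_of S" for a
    proof -
      have "(\<lambda>x. inv x) ` (T closure_of S) \<subseteq> T closure_of ((\<lambda>x. inv x) ` S)"
        by (rule continuous_map_image_closure_subset[OF continuous_inv])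
      also have "\<dots> \<subseteq> T closure_of S"
        using S by (intro closure_of_mono) (auto intro: subgroup.m_inv_closed[OF S])
      finally show ?thesis
        using that by blast
    qed
    show "a \<otimes> b \<in> T closure_of S" if "a \<in> T closure_of S" "b \<in> T closure_of S" for a b
    proof -
      have "(\<lambda>(x, y). x \<otimes> y) ` ((prod_topology T T) closure_of (S \<times> S))
          \<subseteq> T closure_of ((\<lambda>(x, y). x \<otimes> y) ` (S \<times> S))"
        by (rule continuous_map_image_closure_subset[OF continuous_mult])
      also have "\<dots> \<subseteq> T closure_of S"
        using S by (intro closure_of_mono) (auto intro: subgroup.m_closed[OF S])
      finally show ?thesis
        using that by (auto simp: closure_of_Times)
    qed
  qed
qed

lemma normal_closure_of:
  assumes "N \<lhd> G"
  shows "T closure_of N \<lhd> G"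
  unfolding normal_inv_iff
proof (intro conjI ballI)
  show "subgroup (T closure_of N) G"
    using assms normal_imp_subgroup subgroup_closure_of by blast
  fix x h assume x: "x \<in> carrier G" and h: "h \<in> T closure_of N"
  have "(\<lambda>y. x \<otimes> y \<otimes> inv x) ` (T closure_of N) \<subseteq> T closure_of ((\<lambda>y. x \<otimes> y \<otimes> inv x) ` N)"
    by (rule continuous_map_image_closure_subset[OF continuous_map_conj[OF x]])
  also have "\<dots> \<subseteq> T closure_of N"
    using assms x by (intro closure_of_mono) (auto simp: normal_inv_iff)
  finally show "x \<otimes> h \<otimes> inv x \<in> T closure_of N"
    using h by blast
qed

text \<open>The normaliser of a closed subgroup is closed.\<close>

lemma normal_if_dense_normaliser:
  assumes N: "subgroup N G" "closedin T N"
    and D: "T closure_of D = carrier G"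
    and conj: "\<And>d n. d \<in> D \<Longrightarrow> d \<in> carrier G \<Longrightarrow> n \<in> N \<Longrightarrow> d \<otimes> n \<otimes> inv d \<in> N"
  shows "N \<lhd> G"
  unfolding normal_inv_iff
proof (intro conjI ballI)
  show "subgroup N G" by fact
  fix x h assume x: "x \<in> carrier G" and h: "h \<in> N"
  have hc: "h \<in> carrier G"
    using h by (rule subgroup.mem_carrier[OF N(1)])
  have "continuous_map T T (\<lambda>x. x \<otimes> h \<otimes> inv x)"
    using hc by (intro continuous_map_group_intros) auto
  then have "closedin T {x \<in> topspace T. x \<otimes> h \<otimes> inv x \<in> N}"
    using N(2) closedin_continuous_map_preimage by blast
  then have "T closure_of (topspace T \<inter> D) \<subseteq> {x \<in> topspace T. x \<otimes> h \<otimes> inv x \<in> N}"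
    by (rule closure_of_minimal[rotated]) (use conj h topspace_eq in auto)
  then show "x \<otimes> h \<otimes> inv x \<in> N"
    using D x closure_of_restrict[of T D] by auto
qed

section \<open>Uniformity over compact sets\<close>

text \<open>The preimage of \<open>W\<close> is open and contains
  \<open>K \<times> {\<one>}\<close>, so the tube lemma puts the product of \<open>K\<close> with
  one identity neighbourhood inside it. This makes the choice of small neighbourhoods uniform over a
  compact set.\<close>

lemma tube:
  assumes "compactin Z K" "continuous_map (prod_topology Z T) T' f"
    and "openin T' W" "\<And>k. k \<in> K \<Longrightarrow> f (k, \<one>) \<in> W"
  obtains V where "openin T V" "\<one> \<in> V" "\<And>k v. k \<in> K \<Longrightarrow> v \<in> V \<Longrightarrow> f (k, v) \<in> W"
proof -
  have o: "openin (prod_topology Z T) {p \<in> topspace (prod_topology Z T). f p \<in> W}"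
    using assms(2,3) openin_continuous_map_preimage by blast
  have K: "K \<subseteq> topspace Z"
    using assms(1) compactin_subset_topspace by blast
  have "\<exists>U V. openin Z U \<and> openin T V \<and> K \<subseteq> U \<and> \<one> \<in> V \<and>
      U \<times> V \<subseteq> {p \<in> topspace (prod_topology Z T). f p \<in> W}"
    by (rule tube_lemma_left[OF o assms(1)]) (use assms(4) K topspace_eq in auto)
  then show ?thesis
    using that by blast
qed

lemma conj_compact_nhd:
  assumes K: "compactin T K" and U: "openin T U" "\<one> \<in> U"
  obtains V where "openin T V" "\<one> \<in> V" "\<And>k v. k \<in> K \<Longrightarrow> v \<in> V \<Longrightarrow> k \<otimes> v \<otimes> inv k \<in> U"
proof -
  have "continuous_map (prod_topology T T) T (\<lambda>p. fst p \<otimes> snd p \<otimes> inv (fst p))"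
    by (intro continuous_map_group_intros)
  from tube[OF K this U(1)] show ?thesis
    using that U(2) compact_subset_carrier[OF K] by (auto simp: subset_iff)
qed

lemma open_subgroup_normalised_by_compact:
  assumes U: "compactin T U" "subgroup U G" and W: "openin T W" "\<one> \<in> W" "subgroup W G"
  obtains V where "subgroup V G" "openin T V" "V \<subseteq> W"
    "\<And>u v. u \<in> U \<Longrightarrow> v \<in> V \<Longrightarrow> u \<otimes> v \<otimes> inv u \<in> V"
proof -
  note [simp] = subgroup.mem_carrier[OF U(2)] subgroup.mem_carrier[OF W(3)]
  obtain Q where Q: "openin T Q" "\<one> \<in> Q" "\<And>u v. u \<in> U \<Longrightarrow> v \<in> Q \<Longrightarrow> u \<otimes> v \<otimes> inv u \<in> W"
    using conj_compact_nhd[OF U(1) W(1,2)] by blast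
  \<comment> \<open>The intersection of the conjugates of \<open>W\<close> by the elements of
    \<open>U\<close>. It is invariant under \<open>U\<close> because \<open>U\<close> is a group,
    and open because it contains the neighbourhood \<open>Q\<close>, which is uniform over the
    compact set \<open>U\<close>.\<close>
  define V where "V = {y \<in> carrier G. \<forall>u\<in>U. u \<otimes> y \<otimes> inv u \<in> W}"
  have V: "subgroup V G"
  proof (rule subgroupI)
    show "V \<noteq> {}"
      unfolding V_def using W(2) by (auto intro!: exI[of _ \<one>])
    show "inv a \<in> V" if a: "a \<in> V" for a
    proof -
      have "u \<otimes> inv a \<otimes> inv u \<in> W" if "u \<in> U" for u
      proof -
        have "inv (u \<otimes> a \<otimes> inv u) \<in> W"
          using a that unfolding V_def by (auto intro: subgroup.m_inv_closed[OF W(3)])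
        then show ?thesis
          using a that unfolding V_def by (auto simp: inv_mult_group m_assoc)
      qed
      then show ?thesis
        using a unfolding V_def by auto
    qed
    show "a \<otimes> b \<in> V" if ab: "a \<in> V" "b \<in> V" for a b
    proof -
      have "u \<otimes> (a \<otimes> b) \<otimes> inv u \<in> W" if u: "u \<in> U" for u
      proof -
        have c: "a \<in> carrier G" "b \<in> carrier G" "u \<in> carrier G"
          using ab u unfolding V_def by auto
        have "(u \<otimes> a \<otimes> inv u) \<otimes> (u \<otimes> b \<otimes> inv u) \<in> W"
          using ab u unfolding V_def by (blast intro: subgroup.m_closed[OF W(3)])
        also have "(u \<otimes> a \<otimes> inv u) \<otimes> (u \<otimes> b \<otimes> inv u) = u \<otimes> a \<otimes> (inv u \<otimes> u) \<otimes> b \<otimes> inv u"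
          using c by (simp only: m_assoc m_closed inv_closed)
        also have "\<dots> = u \<otimes> a \<otimes> b \<otimes> inv u"
          using c by simp
        also have "\<dots> = u \<otimes> (a \<otimes> b) \<otimes> inv u"
          using c by (simp add: m_assoc)
        finally show ?thesis .
      qed
      then show ?thesis
        using ab unfolding V_def by auto
    qed
  qed (auto simp: V_def)
  have QV: "Q \<subseteq> V"
    unfolding V_def using Q(3) open_subset_carrier[OF Q(1)] by auto
  show ?thesis
  proof
    show "subgroup V G" by fact
    show "openin T V"
      by (rule subgroup_openin[OF V Q(1,2) QV])
    show "V \<subseteq> W"
    proof
      fix v assume v: "v \<in> V"
      then have "\<one> \<otimes> v \<otimes> inv \<one> \<in> W"
        unfolding V_def using subgroup.one_closed[OF U(2)] by blast
      then show "v \<in> W"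
        using v unfolding V_def by simp
    qed
    fix u v assume uv: "u \<in> U" "v \<in> V"
    have c: "u \<in> carrier G" "v \<in> carrier G"
      using uv unfolding V_def by auto
    have "w \<otimes> (u \<otimes> v \<otimes> inv u) \<otimes> inv w \<in> W" if w: "w \<in> U" for w
    proof -
      have "(w \<otimes> u) \<otimes> v \<otimes> inv (w \<otimes> u) \<in> W"
        using subgroup.m_closed[OF U(2) w uv(1)] uv(2) unfolding V_def by blast
      then show ?thesis
        using w c by (simp add: inv_mult_group m_assoc)
    qed
    then show "u \<otimes> v \<otimes> inv u \<in> V"
      unfolding V_def using c by auto
  qed
qed

section \<open>Discrete subgroups\<close>

text \<open>Left translation by \<open>s\<close> carries a neighbourhood isolating
  \<open>\<one>\<close> to one isolating \<open>s\<close>, so discreteness can be tested at the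
  identity alone.\<close>

lemma discrete_in_subgroup_iff:
  assumes S: "subgroup S G"
  shows "discrete_in T S \<longleftrightarrow> (\<exists>U. openin T U \<and> \<one> \<in> U \<and> U \<inter> S \<subseteq> {\<one>})"
proof
  assume "discrete_in T S"
  then have "openin (subtopology T S) {\<one>}"
    using subgroup.one_closed[OF S] by (simp add: discrete_in_def)
  then show "\<exists>U. openin T U \<and> \<one> \<in> U \<and> U \<inter> S \<subseteq> {\<one>}"
    by (auto simp: openin_subtopology)
next
  assume "\<exists>U. openin T U \<and> \<one> \<in> U \<and> U \<inter> S \<subseteq> {\<one>}"
  then obtain U where U: "openin T U" "\<one> \<in> U" "U \<inter> S \<subseteq> {\<one>}"
    by blast
  have Sc: "S \<subseteq> carrier G"
    using S subgroup.subset by blast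
  have "openin (subtopology T S) {s}" if s: "s \<in> S" for s
  proof -
    have sc: "s \<in> carrier G"
      using s Sc by blast
    have "(s <# U) \<inter> S = {s}"
    proof (intro equalityI subsetI)
      fix x assume "x \<in> (s <# U) \<inter> S"
      then obtain u where u: "u \<in> U" "x = s \<otimes> u" "x \<in> S"
        unfolding l_coset_def by blast
      have uc: "u \<in> carrier G"
        using u U open_subset_carrier by blast
      have "inv s \<otimes> x \<in> S"
        using u s S by (simp add: subgroup.m_closed subgroup.m_inv_closed)
      then have "u \<in> S"
        using u uc sc by (simp add: m_assoc[symmetric])
      then show "x \<in> {s}"
        using u U sc by auto
    qed (use mem_l_coset_self[OF U(2) sc] s in auto)
    then show ?thesis
      using open_l_coset[OF U(1) sc] by (metis openin_subtopology)
  qed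
  then show "discrete_in T S"
    unfolding discrete_in_def using Sc
    by (subst eq_commute, subst discrete_topology_unique) (auto simp: topspace_eq)
qed

lemma discrete_in_subset:
  "discrete_in T S \<Longrightarrow> R \<subseteq> S \<Longrightarrow> discrete_in T R"
  unfolding discrete_in_def
  by (metis inf.absorb_iff2 subtopology_discrete_topology subtopology_subtopology)

section \<open>Cocompact subgroups\<close>

lemma compact_covered_by_r_cosets:
  assumes K: "compactin T K" and O: "openin T U" "\<one> \<in> U"
  obtains F where "finite F" "F \<subseteq> K" "K \<subseteq> (\<Union>f\<in>F. U #> f)"
proof -
  have Kc: "K \<subseteq> carrier G"
    using compact_subset_carrier[OF K] .
  have "\<And>k. k \<in> K \<Longrightarrow> k \<in> U #> k"
    using mem_r_coset_self[OF O(2)] Kc by blast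
  then have "K \<subseteq> \<Union>((\<lambda>k. U #> k) ` K)"
    by blast
  moreover have "\<forall>W\<in>(\<lambda>k. U #> k) ` K. openin T W"
    using open_r_coset[OF O(1)] Kc by auto
  ultimately obtain \<F> where "finite \<F>" "\<F> \<subseteq> (\<lambda>k. U #> k) ` K" "K \<subseteq> \<Union>\<F>"
    using K unfolding compactin_def by meson
  then show ?thesis
    using that by (metis finite_subset_image)
qed

text \<open>If \<open>G = \<Gamma>C\<close>, then \<open>\<Gamma>\<close> meets only finitely many of the cosets \<open>Uf\<close> covering \<open>C\<^sup>-\<^sup>1\<close>.\<close>

lemma cocompact_Int_open_subgroup:
  assumes \<Gamma>: "subgroup \<Gamma> G" and U: "subgroup U G" "openin T U"
    and C: "compactin T C" "\<And>g. g \<in> carrier G \<Longrightarrow> \<exists>h\<in>\<Gamma>. \<exists>c\<in>C. g = h \<otimes> c"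
  obtains K where "compactin T K" "\<And>g. g \<in> U \<Longrightarrow> \<exists>h\<in>\<Gamma> \<inter> U. \<exists>k\<in>K. g = h \<otimes> k"
proof -
  note [simp] = subgroup.mem_carrier[OF U(1)] subgroup.mem_carrier[OF \<Gamma>]
  have Cc: "\<And>c. c \<in> C \<Longrightarrow> c \<in> carrier G"
    using compact_subset_carrier[OF C(1)] by blast
  obtain F where F: "finite F" "F \<subseteq> set_inv C" "set_inv C \<subseteq> (\<Union>f\<in>F. U #> f)"
    using compact_covered_by_r_cosets[OF compact_set_inv[OF C(1)] U(2)] U(1) subgroup.one_closed
    by blast
  have Fc: "f \<in> carrier G" if "f \<in> F" for f
    using F(2) that Cc by (auto simp: SET_INV_def)
  define F' where "F' = {f \<in> F. \<Gamma> \<inter> (U #> f) \<noteq> {}}"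
  have "\<forall>f\<in>F'. \<exists>g. g \<in> \<Gamma> \<inter> (U #> f)"
    unfolding F'_def by blast
  then obtain r where r: "\<And>f. f \<in> F' \<Longrightarrow> r f \<in> \<Gamma> \<inter> (U #> f)"
    by metis
  define K where "K = (\<Union>f\<in>F'. r f <# C)"
  show ?thesis
  proof
    show "compactin T K"
      unfolding K_def
    proof (rule compactin_Union)
      show "finite ((\<lambda>f. r f <# C) ` F')"
        using F(1) by (simp add: F'_def)
    qed (use r compact_l_coset[OF C(1)] in auto)
    fix g assume g: "g \<in> U"
    then obtain h c where hc: "h \<in> \<Gamma>" "c \<in> C" "g = h \<otimes> c"
      using C(2)[of g] by auto
    note [simp] = Cc[OF hc(2)]
    have "inv c \<in> set_inv C"
      using hc by (auto simp: SET_INV_def)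
    then obtain f u where f: "f \<in> F" and u: "u \<in> U" "inv c = u \<otimes> f"
      using F(3) by (auto simp: r_coset_def)
    note [simp] = Fc[OF f]
    have "h = g \<otimes> inv c"
      using hc g by (simp add: m_assoc)
    then have h: "h = (g \<otimes> u) \<otimes> f"
      using u g by (simp add: m_assoc)
    have gu: "g \<otimes> u \<in> U"
      using g u U(1) by (simp add: subgroup.m_closed)
    have f': "f \<in> F'"
      unfolding F'_def using f hc(1) h gu by (auto simp: r_coset_def)
    obtain v where v: "v \<in> U" "r f = v \<otimes> f" and rG: "r f \<in> \<Gamma>"
      using r[OF f'] by (auto simp: r_coset_def)
    \<comment> \<open>Both \<open>h\<close> and \<open>r f\<close> lie in \<open>U #> f\<close>, so
      \<open>h \<otimes> inv (r f)\<close> lies in \<open>U\<close>. This is the factor in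
      \<open>\<Gamma> \<inter> U\<close>, and \<open>r f \<otimes> c\<close> is the compact
      one.\<close>
    have eq: "h \<otimes> inv (r f) = (g \<otimes> u) \<otimes> inv v"
      using v gu h by (simp add: inv_mult_group m_assoc inv_solve_right)
    have "h \<otimes> inv (r f) \<in> \<Gamma> \<inter> U"
    proof
      show "h \<otimes> inv (r f) \<in> \<Gamma>"
        using hc(1) rG \<Gamma> by (simp add: subgroup.m_closed subgroup.m_inv_closed)
      show "h \<otimes> inv (r f) \<in> U"
        unfolding eq using gu v U(1) by (simp add: subgroup.m_closed subgroup.m_inv_closed)
    qed
    moreover have "r f \<otimes> c \<in> K"
      unfolding K_def using f' hc(2) by (auto simp: l_coset_def)
    moreover have "g = (h \<otimes> inv (r f)) \<otimes> (r f \<otimes> c)"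
      using hc(1,3) rG by (simp add: m_assoc[symmetric]) (simp add: m_assoc)
    ultimately show "\<exists>h\<in>\<Gamma> \<inter> U. \<exists>k\<in>K. g = h \<otimes> k"
      by blast
  qed
qed

text \<open>With \<open>L\<close> a compact set containing \<open>K\<close> and symmetric generators of \<open>G\<close>, the subgroup
  generated by \<open>M \<inter> LLL\<^sup>-\<^sup>1\<close> is all of \<open>M\<close>, since its product with \<open>L\<close> is stable under right
  multiplication by \<open>L\<close>.\<close>

lemma cocompact_subgroup_compactly_generated:
  assumes cg: "compactly_generated G T" and M: "subgroup M G"
    and K: "compactin T K" "\<And>g. g \<in> carrier G \<Longrightarrow> \<exists>m\<in>M. \<exists>k\<in>K. g = m \<otimes> k"
  obtains C where "compactin T C" "generate G (M \<inter> C) = M"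
proof -
  obtain S where S: "compactin T S" "generate G S = carrier G"
    using cg by (auto simp: compactly_generated_def)
  define L where "L = K \<union> S \<union> set_inv S \<union> {\<one>}"
  have L: "compactin T L"
    unfolding L_def using K(1) S(1) by (intro compactin_Un compact_set_inv) (auto simp: topspace_eq)
  note Lc[simp] = subsetD[OF compact_subset_carrier[OF L]]
  note [simp] = subgroup.mem_carrier[OF M]
  define C where "C = L <#> L <#> set_inv L"
  have C: "compactin T C"
    unfolding C_def using L by (intro compact_set_mult compact_set_inv)
  have CI: "a \<otimes> b \<otimes> inv c \<in> C" if "a \<in> L" "b \<in> L" "c \<in> L" for a b c
    unfolding C_def set_mult_def SET_INV_def using that by blast
  define H where "H = generate G (M \<inter> C)"
  have H: "subgroup H G"
    unfolding H_def by (rule generate_is_subgroup) auto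
  note [simp] = subgroup.mem_carrier[OF H]
  have HM: "H \<subseteq> M"
    unfolding H_def using M by (simp add: generate_subgroup_incl)
  have one: "\<one> \<in> L"
    by (simp add: L_def)
  have step: "x \<otimes> l \<in> H <#> L" if x: "x \<in> H <#> L" and l: "l \<in> L" for x l
  proof -
    obtain h k where hk: "h \<in> H" "k \<in> L" "x = h \<otimes> k"
      using x by (auto simp: set_mult_def)
    obtain m j where m: "m \<in> M" "j \<in> K" "k \<otimes> l = m \<otimes> j"
      using K(2)[of "k \<otimes> l"] hk l by auto
    have j: "j \<in> L"
      using m by (simp add: L_def)
    \<comment> \<open>The element \<open>m\<close> supplied by the transversal has the form that
      defines \<open>C\<close>, so it belongs to the generated subgroup \<open>H\<close> and can be
      absorbed on the left.\<close>
    have "m = k \<otimes> l \<otimes> inv j"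
      using m(1,3) hk l j by (simp add: inv_solve_right)
    then have "m \<in> H"
      unfolding H_def using CI[OF hk(2) l j] m(1) by (auto intro: generate.incl)
    then have "h \<otimes> m \<in> H"
      using hk H by (simp add: subgroup.m_closed)
    moreover have "x \<otimes> l = h \<otimes> m \<otimes> j"
    proof -
      have "x \<otimes> l = h \<otimes> (k \<otimes> l)"
        using hk l by (simp add: m_assoc)
      also have "\<dots> = h \<otimes> m \<otimes> j"
        using hk m(1,3) j by (simp add: m_assoc)
      finally show ?thesis .
    qed
    ultimately show ?thesis
      using j by (auto simp: set_mult_def)
  qed
  have mem: "x \<otimes> g \<in> H <#> L" if "g \<in> generate G S" "x \<in> H <#> L" for x g
    using that
  proof (induction arbitrary: x rule: generate.induct)
    case one
    then have "x \<in> carrier G"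
      by (auto simp: set_mult_def)
    then show ?case
      using one by simp
  next
    case (incl h)
    then show ?case
      using step by (auto simp: L_def)
  next
    case (inv h)
    then show ?case
      using step[of x "inv h"] by (auto simp: L_def SET_INV_def)
  next
    case (eng h1 h2)
    have "h1 \<in> carrier G" "h2 \<in> carrier G"
      using eng S(2) by auto
    moreover have "x \<in> carrier G"
      using eng by (auto simp: set_mult_def)
    ultimately show ?case
      using eng.IH(2)[OF eng.IH(1)[OF eng.prems]] by (simp add: m_assoc)
  qed
  \<comment> \<open>Starting the right multiplications at \<open>\<one>\<close> gives
    \<open>m = h \<otimes> k\<close> with \<open>k \<in> L\<close>. Then \<open>k\<close> lies in
    \<open>M\<close>, and in \<open>C\<close> because \<open>\<one> \<in> L\<close>, so
    \<open>k \<in> H\<close>.\<close>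
  have "M \<subseteq> H"
  proof
    fix m assume m: "m \<in> M"
    have "\<one> \<in> H <#> L"
      using one subgroup.one_closed[OF H] r_one[OF one_closed]
      unfolding set_mult_def by (metis (no_types, lifting) UN_iff singletonI)
    then have "m \<in> H <#> L"
      using mem[of m \<one>] m S(2) by simp
    then obtain h k where hk: "h \<in> H" "k \<in> L" "m = h \<otimes> k"
      by (auto simp: set_mult_def)
    have "k = inv h \<otimes> m"
      using hk by (simp add: m_assoc[symmetric])
    then have "k \<in> M"
      using hk(1) m HM M by (simp add: subsetD subgroup.m_closed subgroup.m_inv_closed)
    moreover have "k \<in> C"
      using CI[OF hk(2) one one] hk(2) by simp
    ultimately have "k \<in> H"
      unfolding H_def by (auto intro: generate.incl)
    then show "m \<in> H"
      using hk H by (simp add: subgroup.m_closed)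
  qed
  then show ?thesis
    using that C HM H_def by blast
qed

text \<open>The coset map is open, so the images of the translates of one open \<open>U\<close>
  inside a compact \<open>L\<close> cover the compact quotient, and finitely many suffice. This
  gives \<open>G = KH\<close>; taking inverses puts the subgroup on the left, the form in which
  cocompactness is used throughout.\<close>

lemma cocompact_imp_compact_transversal:
  assumes loc: "locally_compact_space T" and H: "subgroup H G" and co: "cocompact G T H"
  obtains K where "compactin T K" "\<And>g. g \<in> carrier G \<Longrightarrow> \<exists>h\<in>H. \<exists>k\<in>K. g = h \<otimes> k"
proof -
  note [simp] = subgroup.mem_carrier[OF H]
  let ?q = "\<lambda>g. g <# H"
  let ?Q = "quotient_topology T ?q"
  obtain U L where U: "openin T U" "\<one> \<in> U" and L: "compactin T L" "U \<subseteq> L"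
    using loc topspace_eq unfolding locally_compact_space_def by (metis one_closed)
  note [simp] = subsetD[OF open_subset_carrier[OF U(1)]]
  note [simp] = subsetD[OF compact_subset_carrier[OF L(1)]]
  have coset: "g \<otimes> h <# H = g <# H" if "g \<in> carrier G" "h \<in> H" for g h
    using lcos_m_assoc[OF subgroup.subset[OF H], of g h] coset_join3[OF _ H, of h] that by simp
  \<comment> \<open>The saturation of \<open>W\<close> is the union of its right translates by
    \<open>H\<close>, hence open.\<close>
  have op: "openin ?Q (?q ` W)" if W: "openin T W" for W
  proof -
    note Wc[simp] = subsetD[OF open_subset_carrier[OF W]]
    have "{x \<in> topspace T. x <# H \<in> ?q ` W} = (\<Union>h\<in>H. W #> h)"
    proof (intro equalityI subsetI)
      fix x assume "x \<in> {x \<in> topspace T. x <# H \<in> ?q ` W}"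
      then obtain w where w: "x \<in> carrier G" "w \<in> W" "x <# H = w <# H"
        by (auto simp: topspace_eq)
      have "x \<in> w <# H"
        using w(3) mem_l_coset_self[OF subgroup.one_closed[OF H] w(1)] by argo
      then obtain h where "h \<in> H" "x = w \<otimes> h"
        unfolding l_coset_def by blast
      then show "x \<in> (\<Union>h\<in>H. W #> h)"
        using w(2) unfolding r_coset_def by blast
    next
      fix x assume "x \<in> (\<Union>h\<in>H. W #> h)"
      then obtain h w where "h \<in> H" "w \<in> W" "x = w \<otimes> h"
        by (auto simp: r_coset_def)
      then show "x \<in> {x \<in> topspace T. x <# H \<in> ?q ` W}"
        using coset by (auto simp: topspace_eq)
    qed
    moreover have "openin T (\<Union>h\<in>H. W #> h)"
      using open_r_coset[OF W] by (intro openin_Union) auto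
    ultimately show ?thesis
      using openin_subset[OF W] by (simp add: openin_quotient_topology image_mono)
  qed
  define \<U> where "\<U> = (\<lambda>g. ?q ` (g <# U)) ` carrier G"
  have "compact_space ?Q"
    using co by (simp add: cocompact_def)
  moreover have "\<forall>W\<in>\<U>. openin ?Q W"
    unfolding \<U>_def using op open_l_coset[OF U(1)] by auto
  moreover have "topspace ?Q \<subseteq> \<Union>\<U>"
  proof
    fix y assume "y \<in> topspace ?Q"
    then obtain g where g: "g \<in> carrier G" "y = g <# H"
      by (auto simp: topspace_eq)
    have "g \<in> g <# U"
      using mem_l_coset_self[OF U(2) g(1)] .
    then show "y \<in> \<Union>\<U>"
      unfolding \<U>_def using g by blast
  qed
  ultimately obtain \<F> where \<F>: "finite \<F>" "\<F> \<subseteq> \<U>" "topspace ?Q \<subseteq> \<Union>\<F>"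
    unfolding compact_space_alt by meson
  then obtain F where F: "finite F" "F \<subseteq> carrier G" "\<F> = (\<lambda>g. ?q ` (g <# U)) ` F"
    unfolding \<U>_def by (meson finite_subset_image)
  define K where "K = (\<Union>f\<in>F. f <# L)"
  have K: "compactin T K"
    unfolding K_def
    by (rule compactin_Union) (use F compact_l_coset[OF L(1)] in auto)
  have 1: "\<exists>k\<in>K. \<exists>h\<in>H. g = k \<otimes> h" if g: "g \<in> carrier G" for g
  proof -
    have "g <# H \<in> \<Union>\<F>"
      using \<F>(3) g by (auto simp: topspace_eq)
    then obtain f u where f: "f \<in> F" "u \<in> U" "g <# H = f \<otimes> u <# H"
      by (auto simp: F(3) l_coset_def[of G _ U])
    have "g \<in> g <# H"
      using mem_l_coset_self[OF subgroup.one_closed[OF H] g] .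
    then obtain h where "h \<in> H" "g = f \<otimes> u \<otimes> h"
      using f(3) by (auto simp: l_coset_def)
    moreover have "f \<otimes> u \<in> K"
      unfolding K_def l_coset_def using f(1,2) L(2) by blast
    ultimately show ?thesis
      by blast
  qed
  have 2: "\<exists>h\<in>H. \<exists>k\<in>set_inv K. g = h \<otimes> k" if g: "g \<in> carrier G" for g
  proof -
    obtain k h where kh: "k \<in> K" "h \<in> H" "inv g = k \<otimes> h"
      using 1[of "inv g"] g by auto
    have kc: "k \<in> carrier G"
      using kh K compact_subset_carrier by blast
    have "g = inv (k \<otimes> h)"
      using kh(3) g by (metis inv_inv)
    also have "\<dots> = inv h \<otimes> inv k"
      using kc kh(2) by (simp add: inv_mult_group)
    finally have "g = inv h \<otimes> inv k" .
    moreover have "inv h \<in> H"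
      using kh(2) H by (simp add: subgroup.m_inv_closed)
    moreover have "inv k \<in> set_inv K"
      using kh(1) unfolding SET_INV_def by blast
    ultimately show ?thesis
      by blast
  qed
  show ?thesis
    by (rule that[OF compact_set_inv[OF K] 2])
qed

end

subsection \<open>Totally disconnected locally compact groups\<close>

context tdlc_group
begin

section \<open>Compact open neighbourhoods and subgroups\<close>

text \<open>In a compact neighbourhood \<open>K\<close> of \<open>\<one>\<close> inside
  \<open>W\<close>, quasi-components are connected components, so the one of \<open>\<one>\<close>
  is a point. By compactness of \<open>K - Q\<close>, a clopen subset \<open>A\<close> of
  \<open>K\<close> separates \<open>\<one>\<close> from \<open>K - Q\<close>; as \<open>A\<close>
  lies in the open set \<open>Q\<close>, it is open in the whole group.\<close>

lemma compact_open_nhd: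
  assumes W: "openin T W" "\<one> \<in> W"
  obtains C where "openin T C" "compactin T C" "\<one> \<in> C" "C \<subseteq> W"
proof -
  have "neighbourhood_base_of (compactin T) T"
    using Hausdorff locally_compact locally_compact_space_neighbourhood_base by blast
  then obtain Q K where Q: "openin T Q" "compactin T K" "\<one> \<in> Q" "Q \<subseteq> K" "K \<subseteq> W"
    using W unfolding neighbourhood_base_of by meson
  define S where "S = subtopology T K"
  have KT: "K \<subseteq> topspace T"
    using Q(2) compactin_subset_topspace by blast
  have tS: "topspace S = K"
    unfolding S_def using KT by (simp add: Int_absorb1)
  have S: "compact_space S" "Hausdorff_space S"
    unfolding S_def using Q(2) Hausdorff
    by (simp_all add: compact_space_subtopology Hausdorff_space_subtopology)
  have one: "\<one> \<in> topspace S"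
    using Q tS by blast
  have "quasi_component_of_set S \<one> = connected_component_of_set S \<one>"
    using quasi_eq_connected_component_of[of S \<one>] S by simp
  moreover have "connected_component_of_set S \<one> \<subseteq> connected_component_of_set T \<one>"
    unfolding S_def connected_component_of_def by (auto simp: connectedin_subtopology)
  moreover have "connected_component_of_set T \<one> = {\<one>}"
    using totally_disconnected unfolding totally_disconnected_space_def topspace_eq by blast
  moreover have "\<one> \<in> quasi_component_of_set S \<one>"
    using one by simp
  ultimately have "quasi_component_of_set S \<one> = {\<one>}"
    by blast
  then have qc: "{\<one>} \<in> quasi_components_of S"
    unfolding quasi_components_of_def using one by (metis image_eqI)
  have "closedin S (K - Q)"
    unfolding S_def closedin_subtopology using Q(1) KT by blast
  then have "compactin S (K - Q)"
    using S(1) closedin_compact_space by blast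
  then have "separated_between S {\<one>} (K - Q)"
    using separated_between_quasi_component_compact[OF qc] Q(3) by (simp add: disjnt_iff)
  then obtain A B where AB: "openin S A" "openin S B" "A \<union> B = K" "disjnt A B" "\<one> \<in> A" "K - Q \<subseteq> B"
    unfolding separated_between_def tS by auto
  obtain A' where A': "openin T A'" "A = A' \<inter> K"
    using AB(1) unfolding S_def openin_subtopology by blast
  have "A \<subseteq> Q"
    using AB(3,4,6) unfolding disjnt_iff by blast
  then have "A = A' \<inter> Q"
    using A'(2) Q(4) by blast
  then have 1: "openin T A"
    using A'(1) Q(1) by blast
  have "A = topspace S - B"
    using AB(3,4) unfolding tS disjnt_iff by blast
  then have "closedin S A"
    using AB(2) by blast
  then have "compactin S A"
    using S(1) closedin_compact_space by blast
  then have 2: "compactin T A"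
    unfolding S_def by (simp add: compactin_subtopology)
  show ?thesis
    using that[OF 1 2 AB(5)] \<open>A \<subseteq> Q\<close> Q(4,5) by blast
qed

text \<open>Van Dantzig's theorem: a compact open neighbourhood \<open>C\<close> of the identity contains the open
  subgroup of the elements that stabilise \<open>C\<close> under right multiplication.\<close>

lemma compact_open_subgroup:
  assumes W: "openin T W" "\<one> \<in> W"
  obtains U where "subgroup U G" "openin T U" "compactin T U" "U \<subseteq> W"
proof -
  obtain C where C: "openin T C" "compactin T C" "\<one> \<in> C" "C \<subseteq> W"
    using compact_open_nhd[OF W] .
  note Cc = subsetD[OF compact_subset_carrier[OF C(2)]]
  have "continuous_map (prod_topology T T) T (\<lambda>p. fst p \<otimes> snd p)"
    by (intro continuous_map_group_intros)
  from tube[OF C(2) this C(1)]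
  obtain V where V: "openin T V" "\<one> \<in> V" "\<And>c v. c \<in> C \<Longrightarrow> v \<in> V \<Longrightarrow> c \<otimes> v \<in> C"
    using Cc by auto
  \<comment> \<open>The second condition makes \<open>U\<close> closed under inversion; right
    multiplication by \<open>g\<close> then maps \<open>C\<close> onto itself.\<close>
  define U where "U = {g \<in> carrier G. (\<forall>c\<in>C. c \<otimes> g \<in> C) \<and> (\<forall>c\<in>C. c \<otimes> inv g \<in> C)}"
  have U: "subgroup U G"
  proof (rule subgroupI)
    show "U \<noteq> {}"
      unfolding U_def using Cc by (auto intro!: exI[of _ \<one>])
    show "a \<otimes> b \<in> U" if "a \<in> U" "b \<in> U" for a b
      using that Cc unfolding U_def by (simp add: m_assoc[symmetric] inv_mult_group)
  qed (auto simp: U_def)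
  define V' where "V' = V \<inter> {x \<in> topspace T. inv x \<in> V}"
  have "openin T V'"
    unfolding V'_def using V(1) openin_continuous_map_preimage[OF continuous_inv V(1)] by blast
  moreover have "\<one> \<in> V'"
    unfolding V'_def using V(2) by (simp add: topspace_eq)
  moreover have "V' \<subseteq> U"
    unfolding V'_def U_def using V(3) by (auto simp: topspace_eq)
  ultimately have oU: "openin T U"
    by (rule subgroup_openin[OF U])
  have UC: "U \<subseteq> C"
    unfolding U_def using C(3) by force
  have "compactin T U"
    using closed_compactin[OF C(2) UC open_subgroup_closed[OF U oU]] .
  then show ?thesis
    using that U oU UC C(4) by blast
qed

section \<open>Discrete subgroups and their cosets\<close>

text \<open>A limit point \<open>x\<close> outside \<open>D\<close> would have two distinct elements
  of \<open>D\<close> in the coset \<open>x <# V\<close>. Their quotient lies in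
  \<open>V \<inter> D\<close>, which is trivial.\<close>

lemma discrete_subgroup_closed:
  assumes D: "subgroup D G" "discrete_in T D"
  shows "closedin T D"
proof -
  obtain W where W: "openin T W" "\<one> \<in> W" "W \<inter> D \<subseteq> {\<one>}"
    using D(2) discrete_in_subgroup_iff[OF D(1)] by blast
  obtain V where V: "subgroup V G" "openin T V" "compactin T V" "V \<subseteq> W"
    using compact_open_subgroup[OF W(1,2)] .
  have "x \<in> D" if x: "x \<in> T closure_of D" for x
  proof (rule ccontr)
    assume xD: "x \<notin> D"
    have xc: "x \<in> carrier G"
      using x topspace_eq by (simp add: in_closure_of)
    have xV: "openin T (x <# V)" "x \<in> x <# V"
      using open_l_coset[OF V(2) xc] mem_l_coset_self[OF subgroup.one_closed[OF V(1)] xc] .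
    have meet: "\<exists>y. y \<in> D \<and> y \<in> M" if "openin T M" "x \<in> M" for M
      using x that unfolding in_closure_of by simp
    obtain d where d: "d \<in> D" "d \<in> x <# V"
      using meet[OF xV] by blast
    \<comment> \<open>Points are closed, so removing \<open>d\<close> from the coset leaves a
      neighbourhood of \<open>x\<close>, which meets \<open>D\<close> again.\<close>
    obtain e where e: "e \<in> D" "e \<in> x <# V" "e \<noteq> d"
    proof -
      have "closedin T {d}"
        using d(1) subgroup.mem_carrier[OF D(1)] Hausdorff
        by (simp add: closedin_Hausdorff_sing_eq topspace_eq)
      with xV(1) have "openin T ((x <# V) - {d})"
        by (rule openin_diff)
      moreover have "x \<in> (x <# V) - {d}"
        using xV(2) xD d(1) by blast
      ultimately show ?thesis
        using meet[of "(x <# V) - {d}"] that by blast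
    qed
    obtain v w where vw: "v \<in> V" "d = x \<otimes> v" "w \<in> V" "e = x \<otimes> w"
      using d(2) e(2) unfolding l_coset_def by blast
    note [simp] = subgroup.mem_carrier[OF V(1)] xc
    have "inv d \<otimes> e = inv v \<otimes> w"
      using vw by (simp add: inv_mult_group m_assoc) (simp add: m_assoc[symmetric])
    moreover have "inv v \<otimes> w \<in> V"
      using vw V(1) by (simp add: subgroup.m_closed subgroup.m_inv_closed)
    moreover have "inv d \<otimes> e \<in> D"
      using d e D(1) by (simp add: subgroup.m_closed subgroup.m_inv_closed)
    ultimately have "inv d \<otimes> e = \<one>"
      using V(4) W(3) by auto
    moreover have "d \<otimes> (inv d \<otimes> e) = e"
      using vw by (simp add: m_assoc[symmetric])
    ultimately have "d = e"
      using vw by simp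
    then show False
      using e by simp
  qed
  then have "T closure_of D \<subseteq> D" ..
  then show ?thesis
    using subgroup.subset[OF D(1)] by (simp add: closure_of_subset_eq[symmetric] topspace_eq)
qed

text \<open>The cosets of \<open>D\<close> are closed, so finitely many that contain a dense set
  fill the group. Outside the closed union of those different from \<open>D\<close>, a neighbourhood
  isolating \<open>\<one>\<close> in \<open>D\<close> contains only \<open>\<one>\<close>.\<close>

lemma discrete_if_dense_subset_finite_Union_cosets:
  assumes D: "subgroup D G" "discrete_in T D"
    and F: "finite F" "F \<subseteq> carrier G"
    and P: "T closure_of P = carrier G" "P \<inter> carrier G \<subseteq> (\<Union>f\<in>F. f <# D)"
  shows "discrete_in T (carrier G)"
proof -
  have cl: "closedin T (f <# D)" if "f \<in> F" for f
    using closed_l_coset[OF discrete_subgroup_closed[OF D]] F(2) that by blast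
  have cov: "carrier G \<subseteq> (\<Union>f\<in>F. f <# D)"
  proof -
    have "closedin T (\<Union>f\<in>F. f <# D)"
      using F(1) cl by (intro closedin_Union) auto
    then have "T closure_of (carrier G \<inter> P) \<subseteq> (\<Union>f\<in>F. f <# D)"
      using P(2) by (intro closure_of_minimal) auto
    then show ?thesis
      using P(1) closure_of_restrict[of T P] topspace_eq by simp
  qed
  obtain U where U: "openin T U" "\<one> \<in> U" "U \<inter> D \<subseteq> {\<one>}"
    using D(2) discrete_in_subgroup_iff[OF D(1)] by blast
  define R where "R = (\<Union>f\<in>F - D. f <# D)"
  have R: "closedin T R"
    unfolding R_def using F(1) cl by (intro closedin_Union) auto
  have "\<one> \<notin> R"
  proof
    assume "\<one> \<in> R"
    then obtain f d where fd: "f \<in> F" "f \<notin> D" "d \<in> D" "\<one> = f \<otimes> d"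
      unfolding R_def l_coset_def by blast
    have "f = inv d"
      using inv_equality[of f d] fd F(2) subgroup.mem_carrier[OF D(1)] by auto
    then show False
      using fd(2,3) subgroup.m_inv_closed[OF D(1)] by simp
  qed
  moreover have "(U - R) \<inter> carrier G \<subseteq> {\<one>}"
  proof
    fix x assume x: "x \<in> (U - R) \<inter> carrier G"
    then obtain f d where fd: "f \<in> F" "d \<in> D" "x = f \<otimes> d"
      using cov unfolding l_coset_def by blast
    have "f \<in> D"
      using x fd unfolding R_def l_coset_def by blast
    then have "x \<in> D"
      using fd(2,3) subgroup.m_closed[OF D(1)] by simp
    then show "x \<in> {\<one>}"
      using x U(3) by blast
  qed
  moreover have "openin T (U - R)"
    using U(1) R by (rule openin_diff)
  ultimately show ?thesis
    using discrete_in_subgroup_iff[OF subgroup_self] U(2) by blast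
qed

section \<open>Non-discrete normal subgroups of quasi just-non-compact groups\<close>

lemma discrete_if_Int_open_subgroup_discrete:
  assumes B: "subgroup B G" and V: "subgroup V G" "openin T V"
    and d: "discrete_in T (B \<inter> V)"
  shows "discrete_in T B"
proof -
  have "subgroup (B \<inter> V) G"
    using B V(1) by (rule subgroups_Inter_pair)
  then obtain U where "openin T U" "\<one> \<in> U" "U \<inter> (B \<inter> V) \<subseteq> {\<one>}"
    using d discrete_in_subgroup_iff by blast
  then have "openin T (U \<inter> V) \<and> \<one> \<in> U \<inter> V \<and> (U \<inter> V) \<inter> B \<subseteq> {\<one>}"
    using V(2) subgroup.one_closed[OF V(1)] by blast
  then show ?thesis
    using discrete_in_subgroup_iff[OF B] by blast
qed

text \<open>The closed normal subgroup generated by \<open>E\<close> is non-discrete, hence cocompact, and it is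
  contained in \<open>P\<close>.\<close>

lemma cocompact_if_contains_conjugates:
  assumes qjnc: "quasi_just_non_compact G T"
    and E: "E \<subseteq> carrier G" "\<not> discrete_in T E"
    and P: "subgroup P G" "closedin T P" "P \<subseteq> D <#> L" and D: "D \<subseteq> carrier G" and L: "compactin T L"
    and conj: "\<And>x e. x \<in> carrier G \<Longrightarrow> e \<in> E \<Longrightarrow> x \<otimes> e \<otimes> inv x \<in> P"
  obtains K where "compactin T K" "\<And>g. g \<in> carrier G \<Longrightarrow> \<exists>d\<in>D. \<exists>k\<in>K. g = d \<otimes> k"
proof -
  define C where "C = (\<Union>x\<in>carrier G. (\<lambda>e. x \<otimes> e \<otimes> inv x) ` E)"
  have Cc: "C \<subseteq> carrier G"
    unfolding C_def using E(1) by auto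
  have "generate G C \<lhd> G"
  proof (rule normal_generateI[OF Cc])
    fix h g assume "h \<in> C" and g: "g \<in> carrier G"
    then obtain x e where xe: "x \<in> carrier G" "e \<in> E" "h = x \<otimes> e \<otimes> inv x"
      unfolding C_def by blast
    have "e \<in> carrier G"
      using xe E by blast
    then have "g \<otimes> h \<otimes> inv g = (g \<otimes> x) \<otimes> e \<otimes> inv (g \<otimes> x)"
      using xe g by (simp add: inv_mult_group m_assoc)
    moreover have "g \<otimes> x \<in> carrier G"
      using g xe by simp
    ultimately show "g \<otimes> h \<otimes> inv g \<in> C"
      unfolding C_def using xe(2) by blast
  qed
  define Y where "Y = T closure_of (generate G C)"
  have Y: "Y \<lhd> G" "closedin T Y"
    unfolding Y_def using normal_closure_of[OF \<open>generate G C \<lhd> G\<close>] by simp_all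
  have EC: "E \<subseteq> C"
  proof
    fix e assume "e \<in> E"
    then have "e = \<one> \<otimes> e \<otimes> inv \<one>"
      using E(1) by auto
    then show "e \<in> C"
      unfolding C_def using \<open>e \<in> E\<close> by blast
  qed
  have gC: "generate G C \<subseteq> carrier G"
    by (rule generate_incl[OF Cc])
  have "C \<subseteq> generate G C"
    by (auto intro: generate.incl)
  then have "E \<subseteq> Y"
    unfolding Y_def using EC closure_of_subset[of "generate G C" T] gC topspace_eq by blast
  then have "\<not> discrete_in T Y"
    using E(2) discrete_in_subset by blast
  then have co: "cocompact G T Y"
    using qjnc Y unfolding quasi_just_non_compact_def by blast
  have "C \<subseteq> P"
    unfolding C_def using conj by blast
  then have "generate G C \<subseteq> P"
    using generate_subgroup_incl[OF _ P(1)] by blast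
  then have YP: "Y \<subseteq> P"
    unfolding Y_def using P(2) by (rule closure_of_minimal)
  obtain K where K: "compactin T K" "\<And>g. g \<in> carrier G \<Longrightarrow> \<exists>h\<in>Y. \<exists>k\<in>K. g = h \<otimes> k"
    using cocompact_imp_compact_transversal[OF locally_compact normal_imp_subgroup[OF Y(1)] co] by blast
  show ?thesis
  proof
    \<comment> \<open>From \<open>G = YK\<close> and \<open>Y \<subseteq> P \<subseteq> DL\<close>
      follows \<open>G = D(LK)\<close>, so \<open>L <#> K\<close> is the compact set for
      \<open>D\<close>.\<close>
    show "compactin T (L <#> K)"
      by (rule compact_set_mult[OF L K(1)])
    fix g assume "g \<in> carrier G"
    then obtain y k where yk: "y \<in> Y" "k \<in> K" "g = y \<otimes> k"
      using K(2) by blast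
    obtain d l where dl: "d \<in> D" "l \<in> L" "y = d \<otimes> l"
      using yk(1) YP P(3) unfolding set_mult_def by blast
    have "g = d \<otimes> (l \<otimes> k)"
      unfolding yk(3) dl(3)
      using dl D compact_subset_carrier[OF L] yk(2) compact_subset_carrier[OF K(1)]
      by (intro m_assoc) auto
    moreover have "l \<otimes> k \<in> L <#> K"
      using dl yk unfolding set_mult_def by blast
    ultimately show "\<exists>d\<in>D. \<exists>k\<in>L <#> K. g = d \<otimes> k"
      using dl(1) by blast
  qed
qed

text \<open>If \<open>A \<inter> B\<close> were discrete, a small compact open subgroup of \<open>B\<close> would centralise a compact
  generating set of \<open>A\<close>, hence \<open>A\<close> itself, and so have only a compact set of conjugates.\<close>

lemma cocompact_Int_nondiscrete:
  assumes qjnc: "quasi_just_non_compact G T" and cg: "compactly_generated G T"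
    and A: "A \<lhd> G" and K: "compactin T K" "\<And>g. g \<in> carrier G \<Longrightarrow> \<exists>a\<in>A. \<exists>k\<in>K. g = a \<otimes> k"
    and B: "B \<lhd> G" "closedin T B" "\<not> discrete_in T B"
  shows "\<not> discrete_in T (A \<inter> B)"
proof
  assume d: "discrete_in T (A \<inter> B)"
  have sA: "subgroup A G" and sB: "subgroup B G"
    using A B(1) normal_imp_subgroup by blast+
  note [simp] = subgroup.mem_carrier[OF sA] subgroup.mem_carrier[OF sB]
  obtain W where W: "openin T W" "\<one> \<in> W" "W \<inter> (A \<inter> B) \<subseteq> {\<one>}"
    using discrete_in_subgroup_iff[OF subgroups_Inter_pair[OF sA sB]] d by blast
  obtain C where C: "compactin T C" "generate G (A \<inter> C) = A"
    using cocompact_subgroup_compactly_generated[OF cg sA K] .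
  have cont: "continuous_map (prod_topology T T) T (\<lambda>p. fst p \<otimes> snd p \<otimes> inv (fst p) \<otimes> inv (snd p))"
    by (intro continuous_map_group_intros)
  have 1: "fst (k, \<one>) \<otimes> snd (k, \<one>) \<otimes> inv (fst (k, \<one>)) \<otimes> inv (snd (k, \<one>)) \<in> W" if "k \<in> C" for k
  proof -
    have "k \<in> carrier G"
      using compact_subset_carrier[OF C(1)] that by blast
    then show ?thesis
      using W(2) by simp
  qed
  obtain V where V: "openin T V" "\<one> \<in> V"
    "\<And>s u. s \<in> C \<Longrightarrow> u \<in> V \<Longrightarrow> s \<otimes> u \<otimes> inv s \<otimes> inv u \<in> W"
    using tube[OF C(1) cont W(1) 1] by auto
  obtain U where U: "subgroup U G" "openin T U" "compactin T U" "U \<subseteq> V"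
    using compact_open_subgroup[OF V(1,2)] .
  note [simp] = subgroup.mem_carrier[OF U(1)]
  \<comment> \<open>The centraliser of \<open>U \<inter> B\<close>. It is a subgroup, so it contains
    \<open>A\<close> once it contains the generators \<open>A \<inter> C\<close>.\<close>
  define Z where "Z = {g \<in> carrier G. \<forall>u\<in>U \<inter> B. g \<otimes> u = u \<otimes> g}"
  have Z: "subgroup Z G"
  proof (rule subgroupI)
    show "Z \<noteq> {}"
      unfolding Z_def by (auto intro!: exI[of _ \<one>])
    show "inv a \<in> Z" if a: "a \<in> Z" for a
    proof -
      have "inv a \<otimes> u = u \<otimes> inv a" if u: "u \<in> U \<inter> B" for u
      proof -
        have c: "a \<in> carrier G" "u \<in> carrier G" and au: "a \<otimes> u = u \<otimes> a"
          using a u unfolding Z_def by auto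
        have "inv a \<otimes> u = inv a \<otimes> (u \<otimes> a) \<otimes> inv a"
          using c by (simp add: m_assoc)
        also have "\<dots> = u \<otimes> inv a"
          unfolding au[symmetric] using c by (simp add: m_assoc[symmetric])
        finally show ?thesis .
      qed
      then show ?thesis
        using a unfolding Z_def by auto
    qed
    show "a \<otimes> b \<in> Z" if ab: "a \<in> Z" "b \<in> Z" for a b
    proof -
      have "a \<otimes> b \<otimes> u = u \<otimes> (a \<otimes> b)" if u: "u \<in> U \<inter> B" for u
      proof -
        have c: "a \<in> carrier G" "b \<in> carrier G" "u \<in> carrier G"
          using ab u unfolding Z_def by auto
        have "a \<otimes> b \<otimes> u = a \<otimes> (b \<otimes> u)"
          using c by (simp add: m_assoc)
        also have "\<dots> = a \<otimes> (u \<otimes> b)"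
          using ab u unfolding Z_def by auto
        also have "\<dots> = a \<otimes> u \<otimes> b"
          using c by (simp add: m_assoc)
        also have "\<dots> = u \<otimes> a \<otimes> b"
          using ab u unfolding Z_def by auto
        finally show ?thesis
          using c by (simp add: m_assoc)
      qed
      then show ?thesis
        using ab unfolding Z_def by auto
    qed
  qed (auto simp: Z_def)
  have "A \<inter> C \<subseteq> Z"
  proof
    fix s assume s: "s \<in> A \<inter> C"
    have "s \<otimes> u = u \<otimes> s" if u: "u \<in> U \<inter> B" for u
    proof -
      have c: "s \<in> carrier G" "u \<in> carrier G"
        using s u by auto
      \<comment> \<open>By normality the commutator of \<open>s\<close> and \<open>u\<close> lies in
        \<open>A \<inter> B\<close>, and by the choice of \<open>V\<close> it lies in
        \<open>W\<close>, so it is trivial.\<close>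
      have "s \<otimes> u \<otimes> inv s \<in> B"
        using normal_invE(2)[OF B(1) c(1)] u by blast
      then have "s \<otimes> u \<otimes> inv s \<otimes> inv u \<in> B"
        using u subgroup.m_closed[OF sB] subgroup.m_inv_closed[OF sB] by simp
      moreover have "u \<otimes> inv s \<otimes> inv u \<in> A"
        using normal_invE(2)[OF A c(2)] s subgroup.m_inv_closed[OF sA] by simp
      then have "s \<otimes> (u \<otimes> inv s \<otimes> inv u) \<in> A"
        using s subgroup.m_closed[OF sA] by simp
      then have "s \<otimes> u \<otimes> inv s \<otimes> inv u \<in> A"
        using c by (simp add: m_assoc)
      moreover have "s \<otimes> u \<otimes> inv s \<otimes> inv u \<in> W"
        using V(3) s u U(4) by blast
      ultimately have e: "s \<otimes> u \<otimes> inv s \<otimes> inv u = \<one>"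
        using W(3) by blast
      have "s \<otimes> u = s \<otimes> u \<otimes> inv s \<otimes> inv u \<otimes> u \<otimes> s"
        using c by (simp add: m_assoc)
      then show ?thesis
        using c by (simp add: e)
    qed
    then show "s \<in> Z"
      using s unfolding Z_def by auto
  qed
  then have AZ: "A \<subseteq> Z"
    using generate_subgroup_incl[OF _ Z] C(2) by blast
  \<comment> \<open>On \<open>U \<inter> B\<close>, conjugation by any \<open>x\<close> reduces to
    conjugation by an element of \<open>set_inv K\<close>, since \<open>A\<close> centralises
    \<open>U \<inter> B\<close>. The set \<open>V'\<close> is small enough for these conjugates to
    stay in \<open>U\<close>.\<close>
  obtain V' where V': "openin T V'" "\<one> \<in> V'" "\<And>k v. k \<in> set_inv K \<Longrightarrow> v \<in> V' \<Longrightarrow> k \<otimes> v \<otimes> inv k \<in> U"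
    using conj_compact_nhd[OF compact_set_inv[OF K(1)] U(2) subgroup.one_closed[OF U(1)]] by blast
  have "openin T (V' \<inter> U)" "\<one> \<in> V' \<inter> U"
    using V'(1,2) U(2) subgroup.one_closed[OF U(1)] by auto
  then obtain V'' where V'': "subgroup V'' G" "openin T V''" "compactin T V''" "V'' \<subseteq> V' \<inter> U"
    using compact_open_subgroup by blast
  have nd: "\<not> discrete_in T (B \<inter> V'')"
    using discrete_if_Int_open_subgroup_discrete[OF sB V''(1,2)] B(3) by blast
  have P: "subgroup (U \<inter> B) G" "closedin T (U \<inter> B)"
    using subgroups_Inter_pair[OF U(1) sB] open_subgroup_closed[OF U(1,2)] B(2) by auto
  have PL: "U \<inter> B \<subseteq> {\<one>} <#> (U \<inter> B)"
    unfolding set_mult_def by auto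
  have cUB: "compactin T (U \<inter> B)"
    using closed_compactin[OF U(3) _ P(2)] by blast
  have conj: "x \<otimes> e \<otimes> inv x \<in> U \<inter> B" if x: "x \<in> carrier G" and e: "e \<in> B \<inter> V''" for x e
  proof
    show "x \<otimes> e \<otimes> inv x \<in> B"
      using normal_invE(2)[OF B(1) x] e by blast
    obtain a k where ak: "a \<in> A" "k \<in> K" "inv x = a \<otimes> k"
      using K(2)[of "inv x"] x by auto
    have kc: "k \<in> carrier G"
      using ak(2) compact_subset_carrier[OF K(1)] by blast
    have ac: "a \<in> carrier G" and ec: "e \<in> carrier G"
      using ak e by auto
    have "a \<in> Z" "e \<in> U \<inter> B"
      using AZ ak(1) e V''(4) by blast+
    then have "e \<otimes> a = a \<otimes> e"
      unfolding Z_def by simp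
    have "x = inv k \<otimes> inv a"
      using ak(3) x ac kc by (metis inv_inv inv_mult_group)
    then have "x \<otimes> e \<otimes> inv x = inv k \<otimes> inv a \<otimes> (e \<otimes> a) \<otimes> k"
      unfolding ak(3) using ac kc ec by (simp add: m_assoc)
    also have "\<dots> = inv k \<otimes> (inv a \<otimes> a) \<otimes> e \<otimes> k"
      unfolding \<open>e \<otimes> a = a \<otimes> e\<close> using ac kc ec by (simp only: m_assoc m_closed inv_closed)
    also have "\<dots> = inv k \<otimes> e \<otimes> inv (inv k)"
      using ac kc ec by simp
    also have "\<dots> \<in> U"
      using V'(3)[of "inv k" e] ak(2) e V''(4) unfolding SET_INV_def by blast
    finally show "x \<otimes> e \<otimes> inv x \<in> U" .
  qed
  have BV: "B \<inter> V'' \<subseteq> carrier G" and one: "{\<one>} \<subseteq> carrier G"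
    by auto
  \<comment> \<open>The trivial subgroup is taken as \<open>D\<close>, so that its cocompactness
    means compactness of the whole group.\<close>
  obtain Q where Q: "compactin T Q" "\<And>g. g \<in> carrier G \<Longrightarrow> \<exists>d\<in>{\<one>}. \<exists>k\<in>Q. g = d \<otimes> k"
    using cocompact_if_contains_conjugates[OF qjnc BV nd P PL one cUB conj] by blast
  have "carrier G \<subseteq> Q"
    using Q(2) compact_subset_carrier[OF Q(1)] by force
  then have "carrier G = Q"
    using compact_subset_carrier[OF Q(1)] by blast
  then have "compact_space T"
    using Q(1) by (simp add: compact_space_def topspace_eq)
  then show False
    using qjnc by (simp add: quasi_just_non_compact_def)
qed

lemma cocompact_normal_nondiscrete:
  assumes qjnc: "quasi_just_non_compact G T" and cg: "compactly_generated G T"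
    and nd: "\<not> discrete_in T (carrier G)"
    and A: "A \<lhd> G" and K: "compactin T K" "\<And>g. g \<in> carrier G \<Longrightarrow> \<exists>a\<in>A. \<exists>k\<in>K. g = a \<otimes> k"
  shows "\<not> discrete_in T A"
proof -
  have "carrier G \<lhd> G"
    unfolding normal_inv_iff using subgroup_self by simp
  moreover have "closedin T (carrier G)"
    using topspace_eq closedin_topspace[of T] by simp
  ultimately have "\<not> discrete_in T (A \<inter> carrier G)"
    using cocompact_Int_nondiscrete[OF qjnc cg A K _ _ nd] by blast
  moreover have "A \<inter> carrier G = A"
    using subgroup.subset[OF normal_imp_subgroup[OF A]] by blast
  ultimately show ?thesis
    by simp
qed

end

subsection \<open>Subgroups of a product of two groups\<close>

text \<open>For a subgroup \<open>H\<close> of \<open>X \<times> Y\<close> this is the projection to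
  \<open>X\<close> of \<open>H \<inter> (X \<times> V)\<close>; for trivial \<open>V\<close> it is
  \<open>H \<inter> X\<close>.\<close>

definition slice :: "('a \<times> 'b) set \<Rightarrow> 'b set \<Rightarrow> 'a set" where
  "slice H V = {x. \<exists>v\<in>V. (x, v) \<in> H}"

lemma slice_mono: "V \<subseteq> W \<Longrightarrow> slice H V \<subseteq> slice H W"
  unfolding slice_def by blast

lemma topological_group_DirProd:
  assumes "topological_group X TX" "topological_group Y TY"
  shows "topological_group (X \<times>\<times> Y) (prod_topology TX TY)"
proof -
  interpret X: topological_group X TX by fact
  interpret Y: topological_group Y TY by fact
  interpret group "X \<times>\<times> Y"
    by (rule DirProd_group) unfold_locales
  let ?P = "prod_topology TX TY"
  show ?thesis
  proof
    show "topspace ?P = carrier (X \<times>\<times> Y)"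
      by (simp add: X.topspace_eq Y.topspace_eq)
    have f: "continuous_map (prod_topology ?P ?P) TX (\<lambda>z. fst (fst z))"
      "continuous_map (prod_topology ?P ?P) TX (\<lambda>z. fst (snd z))"
      "continuous_map (prod_topology ?P ?P) TY (\<lambda>z. snd (fst z))"
      "continuous_map (prod_topology ?P ?P) TY (\<lambda>z. snd (snd z))"
      by (intro continuous_map_fst_of continuous_map_snd_of continuous_map_fst continuous_map_snd
          continuous_map_compose[of _ ?P, unfolded o_def])+
    have "continuous_map (prod_topology ?P ?P) ?P
        (\<lambda>z. (fst (fst z) \<otimes>\<^bsub>X\<^esub> fst (snd z), snd (fst z) \<otimes>\<^bsub>Y\<^esub> snd (snd z)))"
      using f by (intro continuous_map_pairedI X.continuous_map_group_mult Y.continuous_map_group_mult)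
    moreover have "(\<lambda>(x, y). x \<otimes>\<^bsub>X \<times>\<times> Y\<^esub> y) =
        (\<lambda>z. (fst (fst z) \<otimes>\<^bsub>X\<^esub> fst (snd z), snd (fst z) \<otimes>\<^bsub>Y\<^esub> snd (snd z)))"
      by (auto simp: mult_DirProd')
    ultimately show "continuous_map (prod_topology ?P ?P) ?P (\<lambda>(x, y). x \<otimes>\<^bsub>X \<times>\<times> Y\<^esub> y)"
      by simp
    have "continuous_map ?P ?P (\<lambda>z. (inv\<^bsub>X\<^esub> fst z, inv\<^bsub>Y\<^esub> snd z))"
      by (intro continuous_map_pairedI X.continuous_map_group_inv Y.continuous_map_group_inv
          continuous_map_fst continuous_map_snd)
    then show "continuous_map ?P ?P (\<lambda>x. inv\<^bsub>X \<times>\<times> Y\<^esub> x)"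
    proof (rule continuous_map_eq)
      fix z assume "z \<in> topspace ?P"
      then show "(inv\<^bsub>X\<^esub> fst z, inv\<^bsub>Y\<^esub> snd z) = inv\<^bsub>X \<times>\<times> Y\<^esub> z"
        using inv_DirProd[OF X.group_axioms Y.group_axioms, of "fst z" "snd z"]
        by (auto simp: X.topspace_eq Y.topspace_eq)
    qed
  qed
qed

locale topological_group_pair =
  X: topological_group X TX + Y: topological_group Y TY
  for X :: "('a, 'c) monoid_scheme" (structure) and TX and Y :: "('b, 'd) monoid_scheme" and TY

sublocale topological_group_pair \<subseteq> XY: topological_group "X \<times>\<times> Y" "prod_topology TX TY"
  by (rule topological_group_DirProd) unfold_locales

context topological_group_pair
begin

lemma DirProd_subgroupD:
  assumes "subgroup H (X \<times>\<times> Y)"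
  shows "(x, y) \<in> H \<Longrightarrow> x \<in> carrier X" "(x, y) \<in> H \<Longrightarrow> y \<in> carrier Y"
    "(\<one>, \<one>\<^bsub>Y\<^esub>) \<in> H"
    "(x, y) \<in> H \<Longrightarrow> (x', y') \<in> H \<Longrightarrow> (x \<otimes> x', y \<otimes>\<^bsub>Y\<^esub> y') \<in> H"
    "(x, y) \<in> H \<Longrightarrow> (inv x, inv\<^bsub>Y\<^esub> y) \<in> H"
proof -
  show 1: "(x, y) \<in> H \<Longrightarrow> x \<in> carrier X" and 2: "(x, y) \<in> H \<Longrightarrow> y \<in> carrier Y" for x y
    using subgroup.mem_carrier[OF assms, of "(x, y)"] by simp_all
  show "(\<one>, \<one>\<^bsub>Y\<^esub>) \<in> H"
    using subgroup.one_closed[OF assms] by simp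
  show "(x, y) \<in> H \<Longrightarrow> (x', y') \<in> H \<Longrightarrow> (x \<otimes> x', y \<otimes>\<^bsub>Y\<^esub> y') \<in> H"
    using subgroup.m_closed[OF assms, of "(x, y)" "(x', y')"] by simp
  show "(x, y) \<in> H \<Longrightarrow> (inv x, inv\<^bsub>Y\<^esub> y) \<in> H"
    using subgroup.m_inv_closed[OF assms, of "(x, y)"] 1 2
      inv_DirProd[OF X.group_axioms Y.group_axioms, of x y] by simp
qed

lemma subgroup_slice:
  assumes H: "subgroup H (X \<times>\<times> Y)" and V: "subgroup V Y"
  shows "subgroup (slice H V) X"
proof (rule X.subgroupI)
  note h = DirProd_subgroupD[OF H]
  show "slice H V \<subseteq> carrier X"
    unfolding slice_def using h(1) by blast
  show "slice H V \<noteq> {}"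
    unfolding slice_def using h(3) subgroup.one_closed[OF V] by blast
  show "inv a \<in> slice H V" if "a \<in> slice H V" for a
    using that h(5) subgroup.m_inv_closed[OF V] unfolding slice_def by force
  show "a \<otimes> b \<in> slice H V" if "a \<in> slice H V" "b \<in> slice H V" for a b
    using that h(4) subgroup.m_closed[OF V] unfolding slice_def by force
qed

text \<open>The projection of \<open>H\<close> to \<open>X\<close> normalises
  \<open>H \<inter> X\<close>, since conjugation by \<open>(d, y)\<close> keeps a trivial second
  coordinate trivial. This projection is dense, and the normaliser of a closed subgroup is
  closed.\<close>

lemma slice_one_normal:
  assumes H: "subgroup H (X \<times>\<times> Y)" "closedin (prod_topology TX TY) H"
    and dense: "TX closure_of (fst ` H) = carrier X"
  shows "slice H {\<one>\<^bsub>Y\<^esub>} \<lhd> X" "closedin TX (slice H {\<one>\<^bsub>Y\<^esub>})"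
proof -
  note h = DirProd_subgroupD[OF H(1)]
  have "continuous_map TX (prod_topology TX TY) (\<lambda>x. (x, \<one>\<^bsub>Y\<^esub>))"
    by (intro continuous_map_pairedI X.continuous_map_group_intros Y.continuous_map_group_intros) simp
  then have "closedin TX {x \<in> topspace TX. (x, \<one>\<^bsub>Y\<^esub>) \<in> H}"
    using H(2) by (rule closedin_continuous_map_preimage)
  moreover have "{x \<in> topspace TX. (x, \<one>\<^bsub>Y\<^esub>) \<in> H} = slice H {\<one>\<^bsub>Y\<^esub>}"
    unfolding slice_def X.topspace_eq using h(1) by auto
  ultimately show cl: "closedin TX (slice H {\<one>\<^bsub>Y\<^esub>})"
    by simp
  show "slice H {\<one>\<^bsub>Y\<^esub>} \<lhd> X"
  proof (rule X.normal_if_dense_normaliser[OF _ cl dense])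
    show "subgroup (slice H {\<one>\<^bsub>Y\<^esub>}) X"
      by (rule subgroup_slice[OF H(1) Y.triv_subgroup])
    fix d n assume d: "d \<in> fst ` H" and n: "n \<in> slice H {\<one>\<^bsub>Y\<^esub>}"
    then obtain y where y: "(d, y) \<in> H" and n': "(n, \<one>\<^bsub>Y\<^esub>) \<in> H"
      unfolding slice_def by auto
    have "(d \<otimes> n \<otimes> inv d, y \<otimes>\<^bsub>Y\<^esub> \<one>\<^bsub>Y\<^esub> \<otimes>\<^bsub>Y\<^esub> inv\<^bsub>Y\<^esub> y) \<in> H"
      by (intro h(4) h(5) y n')
    then show "d \<otimes> n \<otimes> inv d \<in> slice H {\<one>\<^bsub>Y\<^esub>}"
      unfolding slice_def using h(2)[OF y] by simp
  qed
qed

text \<open>Cocompactness of \<open>H\<close> passes to its intersection with the open subgroup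
  \<open>X \<times> V\<close>. It remains to factorise the points \<open>(x, 1)\<close> there and to
  project to \<open>X\<close>.\<close>

lemma cocompact_slice:
  assumes H: "subgroup H (X \<times>\<times> Y)" and V: "subgroup V Y" "openin TY V"
    and C: "compactin (prod_topology TX TY) C"
      "\<And>p. p \<in> carrier (X \<times>\<times> Y) \<Longrightarrow> \<exists>h\<in>H. \<exists>c\<in>C. p = h \<otimes>\<^bsub>X \<times>\<times> Y\<^esub> c"
  obtains K where "compactin TX K" "\<And>x. x \<in> carrier X \<Longrightarrow> \<exists>m\<in>slice H V. \<exists>k\<in>K. x = m \<otimes> k"
proof -
  have U: "subgroup (carrier X \<times> V) (X \<times>\<times> Y)"
    by (rule DirProd_subgroups[OF X.group_axioms X.subgroup_self Y.group_axioms V(1)])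
  have oU: "openin (prod_topology TX TY) (carrier X \<times> V)"
    using V(2) by (simp add: openin_prod_Times_iff X.topspace_eq[symmetric])
  obtain K where K: "compactin (prod_topology TX TY) K"
    "\<And>g. g \<in> carrier X \<times> V \<Longrightarrow> \<exists>h\<in>H \<inter> (carrier X \<times> V). \<exists>k\<in>K. g = h \<otimes>\<^bsub>X \<times>\<times> Y\<^esub> k"
    using XY.cocompact_Int_open_subgroup[OF H U oU C] by blast
  show ?thesis
  proof
    show "compactin TX (fst ` K)"
      using image_compactin[OF K(1) continuous_map_fst] .
    fix x assume "x \<in> carrier X"
    then have "(x, \<one>\<^bsub>Y\<^esub>) \<in> carrier X \<times> V"
      using subgroup.one_closed[OF V(1)] by simp
    then obtain h k where hk: "h \<in> H" "h \<in> carrier X \<times> V" "k \<in> K"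
      "(x, \<one>\<^bsub>Y\<^esub>) = h \<otimes>\<^bsub>X \<times>\<times> Y\<^esub> k"
      using K(2) by blast
    have "x = fst h \<otimes> fst k"
      using hk(4) by (simp add: mult_DirProd')
    moreover have "fst h \<in> slice H V"
      unfolding slice_def using hk(1,2) by (auto intro!: bexI[of _ "snd h"])
    ultimately show "\<exists>m\<in>slice H V. \<exists>k\<in>fst ` K. x = m \<otimes> k"
      using hk(3) by blast
  qed
qed

end

section \<open>Slices over small open subgroups\<close>

locale tdlc_group_pair = X: tdlc_group X TX + Y: tdlc_group Y TY
  for X :: "('a, 'c) monoid_scheme" (structure) and TX and Y :: "('b, 'd) monoid_scheme" and TY

sublocale tdlc_group_pair \<subseteq> topological_group_pair X TX Y TY
  by unfold_locales

context tdlc_group_pair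
begin

text \<open>Here \<open>H\<inverse>\<close> is the converse relation, that is, \<open>H\<close> with
  the factors exchanged. It allows slices to be taken in \<open>Y\<close>.\<close>

lemma swap_closed_subgroup:
  assumes "subgroup H (X \<times>\<times> Y)" "closedin (prod_topology TX TY) H"
  shows "subgroup (H\<inverse>) (Y \<times>\<times> X)" "closedin (prod_topology TY TX) (H\<inverse>)"
proof -
  interpret YX: group "Y \<times>\<times> X"
    by (rule DirProd_group[OF Y.group_axioms X.group_axioms])
  note h = DirProd_subgroupD[OF assms(1)]
  show "subgroup (H\<inverse>) (Y \<times>\<times> X)"
  proof (rule YX.subgroupI)
    show "H\<inverse> \<subseteq> carrier (Y \<times>\<times> X)"
      using h(1,2) by auto
    show "H\<inverse> \<noteq> {}"
      using h(3) by blast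
    show "inv\<^bsub>Y \<times>\<times> X\<^esub> a \<in> H\<inverse>" if "a \<in> H\<inverse>" for a
      using that h(1,2,5) inv_DirProd[OF Y.group_axioms X.group_axioms, of "fst a" "snd a"]
      by (auto simp del: inv_DirProd)
    show "a \<otimes>\<^bsub>Y \<times>\<times> X\<^esub> b \<in> H\<inverse>" if "a \<in> H\<inverse>" "b \<in> H\<inverse>" for a b
      using that h(4) by auto
  qed
  have "continuous_map (prod_topology TY TX) (prod_topology TX TY) (\<lambda>p. (snd p, fst p))"
    by (intro continuous_map_pairedI continuous_map_fst continuous_map_snd)
  then have "closedin (prod_topology TY TX) {p \<in> topspace (prod_topology TY TX). (snd p, fst p) \<in> H}"
    using assms(2) by (rule closedin_continuous_map_preimage)
  moreover have "{p \<in> topspace (prod_topology TY TX). (snd p, fst p) \<in> H} = H\<inverse>"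
    using h(1,2) by (auto simp: X.topspace_eq Y.topspace_eq)
  ultimately show "closedin (prod_topology TY TX) (H\<inverse>)"
    by simp
qed

text \<open>The closed normal subgroup \<open>D = H \<inter> Y\<close> of \<open>Y\<close> is
  discrete or cocompact. If it is discrete and \<open>V\<close> meets it trivially, a discrete slice
  over \<open>V\<close> would make \<open>H\<close> discrete. If it is cocompact, the projection of
  \<open>H\<close> to \<open>X\<close> is covered by finitely many cosets of the slice, and a
  discrete slice would make \<open>X\<close> discrete.\<close>

lemma small_slices_nondiscrete:
  assumes qjncY: "quasi_just_non_compact Y TY" and ndX: "\<not> discrete_in TX (carrier X)"
    and H: "subgroup H (X \<times>\<times> Y)" "closedin (prod_topology TX TY) H"
    and nd: "\<not> discrete_in (prod_topology TX TY) H"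
    and dense: "TX closure_of (fst ` H) = carrier X" "TY closure_of (snd ` H) = carrier Y"
  obtains U where "subgroup U Y" "openin TY U" "compactin TY U"
    "\<And>V. subgroup V Y \<Longrightarrow> openin TY V \<Longrightarrow> V \<subseteq> U \<Longrightarrow> \<not> discrete_in TX (slice H V)"
proof -
  note h = DirProd_subgroupD[OF H(1)]
  interpret YX: tdlc_group_pair Y TY X TX
    by unfold_locales
  note H' = swap_closed_subgroup[OF H]
  define D where "D = slice (H\<inverse>) {\<one>}"
  have D_iff: "y \<in> D \<longleftrightarrow> (\<one>, y) \<in> H" for y
    unfolding D_def slice_def by simp
  have "fst ` (H\<inverse>) = snd ` H"
    by force
  then have D: "D \<lhd> Y" "closedin TY D"
    unfolding D_def using YX.slice_one_normal[OF H'] dense(2) by simp_all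
  note sD = normal_imp_subgroup[OF D(1)]
  show ?thesis
  proof (cases "discrete_in TY D")
    case True
    then obtain W where W: "openin TY W" "\<one>\<^bsub>Y\<^esub> \<in> W" "W \<inter> D \<subseteq> {\<one>\<^bsub>Y\<^esub>}"
      using Y.discrete_in_subgroup_iff[OF sD] by blast
    obtain U where U: "subgroup U Y" "openin TY U" "compactin TY U" "U \<subseteq> W"
      using Y.compact_open_subgroup[OF W(1,2)] .
    show ?thesis
    proof (rule that[OF U(1-3)])
      fix V assume V: "subgroup V Y" "openin TY V" "V \<subseteq> U"
      show "\<not> discrete_in TX (slice H V)"
      proof
        assume "discrete_in TX (slice H V)"
        then obtain Q where Q: "openin TX Q" "\<one> \<in> Q" "Q \<inter> slice H V \<subseteq> {\<one>}"
          using X.discrete_in_subgroup_iff[OF subgroup_slice[OF H(1) V(1)]] by blast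
        have "openin (prod_topology TX TY) (Q \<times> V)"
          using Q(1) V(2) by (simp add: openin_prod_Times_iff)
        moreover have "\<one>\<^bsub>X \<times>\<times> Y\<^esub> \<in> Q \<times> V"
          using Q(2) subgroup.one_closed[OF V(1)] by simp
        moreover have "(Q \<times> V) \<inter> H \<subseteq> {\<one>\<^bsub>X \<times>\<times> Y\<^esub>}"
        proof
          fix p assume p: "p \<in> (Q \<times> V) \<inter> H"
          obtain x y where p_eq: "p = (x, y)"
            by (rule prod.exhaust)
          have xy: "x \<in> Q" "y \<in> V" "(x, y) \<in> H"
            using p unfolding p_eq by blast+
          then have "x \<in> slice H V"
            unfolding slice_def by blast
          with xy(1) have 1: "x = \<one>"
            using subsetD[OF Q(3), of x] by simp
          have "y \<in> D"
            using xy(3) unfolding D_iff 1 .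
          then have "y = \<one>\<^bsub>Y\<^esub>"
            using subsetD[OF W(3), of y] xy(2) V(3) U(4) by auto
          then show "p \<in> {\<one>\<^bsub>X \<times>\<times> Y\<^esub>}"
            unfolding p_eq 1 by simp
        qed
        ultimately have "discrete_in (prod_topology TX TY) H"
          unfolding XY.discrete_in_subgroup_iff[OF H(1)] by (intro exI[of _ "Q \<times> V"] conjI)
        then show False
          using nd by contradiction
      qed
    qed
  next
    case False
    then have "cocompact Y TY D"
      using qjncY D unfolding quasi_just_non_compact_def by blast
    then obtain K where K: "compactin TY K" "\<And>g. g \<in> carrier Y \<Longrightarrow> \<exists>d\<in>D. \<exists>k\<in>K. g = d \<otimes>\<^bsub>Y\<^esub> k"
      using Y.cocompact_imp_compact_transversal[OF Y.locally_compact sD] by blast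
    note K' = Y.compact_set_inv[OF K(1)]
    note Kc = subsetD[OF Y.compact_subset_carrier[OF K(1)]] subsetD[OF Y.compact_subset_carrier[OF K']]
    have "\<one>\<^bsub>Y\<^esub> \<in> topspace TY"
      by (simp add: Y.topspace_eq)
    then obtain U where U: "subgroup U Y" "openin TY U" "compactin TY U"
      using Y.compact_open_subgroup[OF openin_topspace] by blast
    show ?thesis
    proof (rule that[OF U])
      fix V assume V: "subgroup V Y" "openin TY V" "V \<subseteq> U"
      note Vc = subgroup.mem_carrier[OF V(1)]
      show "\<not> discrete_in TX (slice H V)"
      proof
        assume d: "discrete_in TX (slice H V)"
        obtain F where F: "finite F" "F \<subseteq> set_inv\<^bsub>Y\<^esub> K" "set_inv\<^bsub>Y\<^esub> K \<subseteq> (\<Union>f\<in>F. V #>\<^bsub>Y\<^esub> f)"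
          using Y.compact_covered_by_r_cosets[OF K' V(2) subgroup.one_closed[OF V(1)]] .
        \<comment> \<open>The points of \<open>X\<close> that \<open>H\<close> pairs with an element
          of the left coset of \<open>V\<close> by \<open>inv f\<close>. Two points of one
          \<open>A f\<close> differ by an element of the slice over \<open>V\<close>, so one
          representative \<open>r f\<close> of each non-empty \<open>A f\<close> suffices.\<close>
        define A where "A f = {x. \<exists>v\<in>V. (x, inv\<^bsub>Y\<^esub> f \<otimes>\<^bsub>Y\<^esub> v) \<in> H}" for f
        define F' where "F' = {f \<in> F. A f \<noteq> {}}"
        have "\<forall>f\<in>F'. \<exists>x. x \<in> A f"
          unfolding F'_def by blast
        then obtain r where r: "\<And>f. f \<in> F' \<Longrightarrow> r f \<in> A f"
          by metis
        have rc: "r f \<in> carrier X" if "f \<in> F'" for f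
          using r[OF that] h(1) unfolding A_def by blast
        have "fst ` H \<subseteq> (\<Union>g\<in>r ` F'. g <# slice H V)"
        proof
          fix x assume "x \<in> fst ` H"
          then obtain y where xy: "(x, y) \<in> H"
            by auto
          note xc = h(1)[OF xy]
          obtain e k where e: "e \<in> D" "k \<in> K" "y = e \<otimes>\<^bsub>Y\<^esub> k"
            using K(2)[OF h(2)[OF xy]] by blast
          have k': "inv\<^bsub>Y\<^esub> k \<in> set_inv\<^bsub>Y\<^esub> K"
            unfolding SET_INV_def using e(2) by blast
          obtain f v where f: "f \<in> F" "v \<in> V" "inv\<^bsub>Y\<^esub> k = v \<otimes>\<^bsub>Y\<^esub> f"
            using F(3) k' unfolding r_coset_def by blast
          have c: "e \<in> carrier Y" "k \<in> carrier Y" "f \<in> carrier Y" "v \<in> carrier Y"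
            using subgroup.mem_carrier[OF sD e(1)] Kc e(2) F(2) f(1) Vc[OF f(2)] by auto
          \<comment> \<open>Multiplying by the inverse of \<open>(\<one>, e)\<close>, an element of
            \<open>H\<close>, removes the \<open>D\<close>-part of \<open>y\<close> and leaves
            \<open>x\<close> unchanged.\<close>
          have "(inv \<one> \<otimes> x, inv\<^bsub>Y\<^esub> e \<otimes>\<^bsub>Y\<^esub> y) \<in> H"
            using e(1) xy unfolding D_iff by (intro h(4) h(5))
          moreover have "inv\<^bsub>Y\<^esub> e \<otimes>\<^bsub>Y\<^esub> y = inv\<^bsub>Y\<^esub> f \<otimes>\<^bsub>Y\<^esub> inv\<^bsub>Y\<^esub> v"
            proof -
            have "inv\<^bsub>Y\<^esub> (inv\<^bsub>Y\<^esub> k) = inv\<^bsub>Y\<^esub> (v \<otimes>\<^bsub>Y\<^esub> f)"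
              unfolding f(3) ..
            then show ?thesis
              unfolding e(3) using c by (simp add: Y.m_assoc[symmetric] Y.inv_mult_group)
          qed
          ultimately have xH: "(x, inv\<^bsub>Y\<^esub> f \<otimes>\<^bsub>Y\<^esub> inv\<^bsub>Y\<^esub> v) \<in> H"
            using xc by simp
          then have "x \<in> A f"
            unfolding A_def using subgroup.m_inv_closed[OF V(1) f(2)] by blast
          then have f': "f \<in> F'"
            unfolding F'_def using f(1) by blast
          obtain w where w: "w \<in> V" "(r f, inv\<^bsub>Y\<^esub> f \<otimes>\<^bsub>Y\<^esub> w) \<in> H"
            using r[OF f'] unfolding A_def by blast
          have "(inv (r f) \<otimes> x, inv\<^bsub>Y\<^esub> (inv\<^bsub>Y\<^esub> f \<otimes>\<^bsub>Y\<^esub> w) \<otimes>\<^bsub>Y\<^esub> (inv\<^bsub>Y\<^esub> f \<otimes>\<^bsub>Y\<^esub> inv\<^bsub>Y\<^esub> v)) \<in> H"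
            by (intro h(4) h(5) w(2) xH)
          moreover have "inv\<^bsub>Y\<^esub> (inv\<^bsub>Y\<^esub> f \<otimes>\<^bsub>Y\<^esub> w) \<otimes>\<^bsub>Y\<^esub> (inv\<^bsub>Y\<^esub> f \<otimes>\<^bsub>Y\<^esub> inv\<^bsub>Y\<^esub> v)
              = inv\<^bsub>Y\<^esub> w \<otimes>\<^bsub>Y\<^esub> inv\<^bsub>Y\<^esub> v"
          proof -
            have "inv\<^bsub>Y\<^esub> (inv\<^bsub>Y\<^esub> f \<otimes>\<^bsub>Y\<^esub> w) \<otimes>\<^bsub>Y\<^esub> (inv\<^bsub>Y\<^esub> f \<otimes>\<^bsub>Y\<^esub> inv\<^bsub>Y\<^esub> v)
              = inv\<^bsub>Y\<^esub> w \<otimes>\<^bsub>Y\<^esub> (f \<otimes>\<^bsub>Y\<^esub> inv\<^bsub>Y\<^esub> f) \<otimes>\<^bsub>Y\<^esub> inv\<^bsub>Y\<^esub> v"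
              using c Vc[OF w(1)] by (simp only: Y.inv_mult_group Y.inv_inv Y.m_assoc Y.m_closed Y.inv_closed)
            then show ?thesis
              using c Vc[OF w(1)] by simp
          qed
          moreover have "inv\<^bsub>Y\<^esub> w \<otimes>\<^bsub>Y\<^esub> inv\<^bsub>Y\<^esub> v \<in> V"
            by (intro subgroup.m_closed[OF V(1)] subgroup.m_inv_closed[OF V(1)] w(1) f(2))
          ultimately have "inv (r f) \<otimes> x \<in> slice H V"
            unfolding slice_def by auto
          moreover have "x = r f \<otimes> (inv (r f) \<otimes> x)"
            using rc[OF f'] xc by (simp add: X.m_assoc[symmetric])
          ultimately have "x \<in> r f <# slice H V"
            unfolding l_coset_def by blast
          then show "x \<in> (\<Union>g\<in>r ` F'. g <# slice H V)"
            using f' by blast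
        qed
        then have "fst ` H \<inter> carrier X \<subseteq> (\<Union>g\<in>r ` F'. g <# slice H V)"
          by (rule le_infI1)
        moreover have "finite (r ` F')"
          using F(1) unfolding F'_def by simp
        moreover have "r ` F' \<subseteq> carrier X"
          using rc by (rule image_subsetI)
        ultimately have "discrete_in TX (carrier X)"
          using X.discrete_if_dense_subset_finite_Union_cosets[OF subgroup_slice[OF H(1) V(1)] d _ _ dense(1)]
          by simp
        then show False
          using ndX by contradiction
      qed
    qed
  qed
qed

text \<open>The complement of \<open>H\<close> is open and contains \<open>Q \<times> {1}\<close>,
  so the tube lemma applies. In this sense the slices over small neighbourhoods shrink to
  \<open>H \<inter> X\<close>.\<close>

lemma slice_nhds_eventually_disjoint:
  assumes H: "closedin (prod_topology TX TY) H" and Q: "compactin TX Q" "Q \<inter> slice H {\<one>\<^bsub>Y\<^esub>} = {}"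
  obtains V where "openin TY V" "\<one>\<^bsub>Y\<^esub> \<in> V" "Q \<inter> slice H V = {}"
proof -
  let ?W = "topspace (prod_topology TX TY) - H"
  have "openin (prod_topology TX TY) ?W"
    using H by blast
  moreover have "Q \<times> {\<one>\<^bsub>Y\<^esub>} \<subseteq> ?W"
    using Q X.compact_subset_carrier[OF Q(1)] unfolding slice_def
    by (auto simp: X.topspace_eq Y.topspace_eq)
  ultimately obtain A V where "openin TY V" "Q \<subseteq> A" "\<one>\<^bsub>Y\<^esub> \<in> V" "A \<times> V \<subseteq> ?W"
    using tube_lemma_left[of TX TY ?W Q "\<one>\<^bsub>Y\<^esub>"] Q(1) by (auto simp: Y.topspace_eq)
  then show ?thesis
    using that[of V] unfolding slice_def by blast
qed

end

section \<open>The intersection of a closed cocompact subgroup with a factor\<close>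

context tdlc_group_pair
begin

text \<open>Suppose \<open>D = H \<inter> X\<close> is discrete. The slices of \<open>H\<close> over small open normal subgroups \<open>V\<close> of a
  compact open \<open>U\<^sub>0 \<le> Y\<close> shrink to \<open>D\<close>, and they are normal in the compactly generated, cocompact
  slice \<open>M\<close> over \<open>U\<^sub>0\<close>. As in the theorem of Caprace and Monod on residually discrete groups, for small
  \<open>V\<close> the part \<open>W\<close> of such a slice inside \<open>DU\<close> is normalised by the generators of \<open>M\<close>, since the
  generators cannot move it out of \<open>DU\<close>. As \<open>M\<close> is cocompact, all conjugates of the non-discrete \<open>W\<close>
  then lie in \<open>DL\<close> with \<open>L\<close> compact, and \<open>D\<close> is cocompact.\<close>

theorem slice_one_nondiscrete:
  assumes qjnc: "quasi_just_non_compact X TX" "quasi_just_non_compact Y TY"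
    and cg: "compactly_generated X TX" and ndX: "\<not> discrete_in TX (carrier X)"
    and H: "subgroup H (X \<times>\<times> Y)" "closedin (prod_topology TX TY) H"
    and nd: "\<not> discrete_in (prod_topology TX TY) H"
    and dense: "TX closure_of (fst ` H) = carrier X" "TY closure_of (snd ` H) = carrier Y"
    and C: "compactin (prod_topology TX TY) C"
      "\<And>p. p \<in> carrier (X \<times>\<times> Y) \<Longrightarrow> \<exists>h\<in>H. \<exists>c\<in>C. p = h \<otimes>\<^bsub>X \<times>\<times> Y\<^esub> c"
  shows "\<not> discrete_in TX (slice H {\<one>\<^bsub>Y\<^esub>})"
proof
  note h = DirProd_subgroupD[OF H(1)]
  define D where "D = slice H {\<one>\<^bsub>Y\<^esub>}"
  assume "discrete_in TX (slice H {\<one>\<^bsub>Y\<^esub>})"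
  then have dD: "discrete_in TX D"
    by (simp add: D_def)
  have D: "D \<lhd> X" "closedin TX D"
    unfolding D_def using slice_one_normal[OF H dense(1)] by simp_all
  note sD = normal_imp_subgroup[OF D(1)]
  note Dconj = X.normal_invE(2)[OF D(1)]
  obtain U0 where U0: "subgroup U0 Y" "openin TY U0" "compactin TY U0"
    "\<And>V. subgroup V Y \<Longrightarrow> openin TY V \<Longrightarrow> V \<subseteq> U0 \<Longrightarrow> \<not> discrete_in TX (slice H V)"
    using small_slices_nondiscrete[OF qjnc(2) ndX H nd dense] by metis
  define M where "M = slice H U0"
  have M: "subgroup M X"
    unfolding M_def by (rule subgroup_slice[OF H(1) U0(1)])
  obtain K where K: "compactin TX K" "\<And>x. x \<in> carrier X \<Longrightarrow> \<exists>m\<in>M. \<exists>k\<in>K. x = m \<otimes> k"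
    unfolding M_def using cocompact_slice[OF H(1) U0(1,2) C] by blast
  obtain S where S: "compactin TX S" "generate X (M \<inter> S) = M"
    using X.cocompact_subgroup_compactly_generated[OF cg M K] by blast
  have one_top: "\<one> \<in> topspace TX"
    by (simp add: X.topspace_eq)
  obtain L where L: "subgroup L X" "openin TX L" "compactin TX L"
    using X.compact_open_subgroup[OF openin_topspace one_top] by blast
  \<comment> \<open>Small enough for conjugation by \<open>set_inv K\<close> to map it into
    \<open>L\<close>. This serves at the end, when arbitrary conjugators are reduced to
    \<open>set_inv K\<close> through \<open>M\<close>.\<close>
  obtain U' where U': "openin TX U'" "\<one> \<in> U'"
    "\<And>k v. k \<in> set_inv K \<Longrightarrow> v \<in> U' \<Longrightarrow> k \<otimes> v \<otimes> inv k \<in> L"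
    using X.conj_compact_nhd[OF X.compact_set_inv[OF K(1)] L(2) subgroup.one_closed[OF L(1)]] by blast
  obtain U where U: "subgroup U X" "openin TX U" "compactin TX U" "U \<subseteq> U'"
    using X.compact_open_subgroup[OF U'(1,2)] .
  note carr = subgroup.mem_carrier[OF sD] subgroup.mem_carrier[OF M] subgroup.mem_carrier[OF U(1)]
  define DU where "DU = D <#> U"
  have DU: "subgroup DU X"
    unfolding DU_def by (rule X.mult_norm_subgroup[OF D(1) U(1)])
  have D_DU: "d \<in> DU" if "d \<in> D" for d
  proof -
    have "d = d \<otimes> \<one>"
      using carr(1)[OF that] by simp
    then show ?thesis
      unfolding DU_def set_mult_def using that subgroup.one_closed[OF U(1)] by blast
  qed
  have U_DU: "U \<subseteq> DU"
  proof
    fix u assume u: "u \<in> U"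
    then have "u = \<one> \<otimes> u"
      using carr(3) by simp
    then show "u \<in> DU"
      unfolding DU_def set_mult_def using u subgroup.one_closed[OF sD] by blast
  qed
  have oDU: "openin TX DU"
    by (rule X.subgroup_openin[OF DU U(2) subgroup.one_closed[OF U(1)] U_DU])
  \<comment> \<open>Symmetrised, so that a generator \<open>m\<close> and its inverse are both
    covered below.\<close>
  define S' where "S' = S \<union> set_inv S"
  have S': "compactin TX S'"
    unfolding S'_def by (intro compactin_Un X.compact_set_inv S(1))
  \<comment> \<open>The points outside \<open>DU\<close> that conjugation by generators can reach
    from \<open>U\<close>. This set is compact and misses \<open>D\<close>, so the slices over small
    \<open>V\<close> avoid it.\<close>
  define Q where "Q = (S' <#> U <#> set_inv S') - DU"
  have Q0: "compactin TX (S' <#> U <#> set_inv S')"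
    by (intro X.compact_set_mult X.compact_set_inv S' U(3))
  have "closedin TX Q"
    unfolding Q_def using compactin_imp_closedin[OF X.Hausdorff Q0] oDU by (rule closedin_diff)
  then have Q: "compactin TX Q"
    using closed_compactin[OF Q0, of Q] unfolding Q_def by blast
  have "Q \<inter> slice H {\<one>\<^bsub>Y\<^esub>} = {}"
    using D_DU unfolding Q_def D_def[symmetric] by blast
  then obtain V1 where V1: "openin TY V1" "\<one>\<^bsub>Y\<^esub> \<in> V1" "Q \<inter> slice H V1 = {}"
    using slice_nhds_eventually_disjoint[OF H(2) Q] by blast
  have "openin TY (V1 \<inter> U0)" "\<one>\<^bsub>Y\<^esub> \<in> V1 \<inter> U0"
    using V1(1,2) U0(2) subgroup.one_closed[OF U0(1)] by auto
  then obtain V2 where V2: "subgroup V2 Y" "openin TY V2" "V2 \<subseteq> V1 \<inter> U0"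
    using Y.compact_open_subgroup by blast
  \<comment> \<open>Since \<open>V\<close> is normalised by \<open>U0\<close>, its slice
    \<open>N\<close> is normalised by \<open>M\<close>, the slice over \<open>U0\<close>.\<close>
  obtain V where V: "subgroup V Y" "openin TY V" "V \<subseteq> V2"
    "\<And>u v. u \<in> U0 \<Longrightarrow> v \<in> V \<Longrightarrow> u \<otimes>\<^bsub>Y\<^esub> v \<otimes>\<^bsub>Y\<^esub> inv\<^bsub>Y\<^esub> u \<in> V"
    using Y.open_subgroup_normalised_by_compact[OF U0(3,1) V2(2) subgroup.one_closed[OF V2(1)] V2(1)]
    by blast
  define N where "N = slice H V"
  have N: "subgroup N X"
    unfolding N_def by (rule subgroup_slice[OF H(1) V(1)])
  have ndN: "\<not> discrete_in TX N"
    unfolding N_def using U0(4)[OF V(1,2)] V(3) V2(3) by blast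
  have NQ: "Q \<inter> N = {}"
    unfolding N_def using V1(3) slice_mono[of V V1 H] V(3) V2(3) by blast
  have DN: "D \<subseteq> N"
    unfolding D_def N_def using subgroup.one_closed[OF V(1)] by (intro slice_mono) simp
  have Nconj: "m \<otimes> n \<otimes> inv m \<in> N" if mn: "m \<in> M" "n \<in> N" for m n
  proof -
    obtain u v where uv: "u \<in> U0" "(m, u) \<in> H" "v \<in> V" "(n, v) \<in> H"
      using mn unfolding M_def N_def slice_def by blast
    have "(m \<otimes> n \<otimes> inv m, u \<otimes>\<^bsub>Y\<^esub> v \<otimes>\<^bsub>Y\<^esub> inv\<^bsub>Y\<^esub> u) \<in> H"
      by (intro h(4) h(5) uv)
    then show ?thesis
      unfolding N_def slice_def using V(4)[OF uv(1,3)] by blast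
  qed
  define W where "W = N \<inter> DU"
  have W: "subgroup W X"
    unfolding W_def by (rule X.subgroups_Inter_pair[OF N DU])
  have Wc: "w \<in> carrier X" if "w \<in> W" for w
    by (rule subgroup.mem_carrier[OF W that])
  have split: "x \<otimes> (d \<otimes> n) \<otimes> inv x = (x \<otimes> d \<otimes> inv x) \<otimes> (x \<otimes> n \<otimes> inv x)"
    if "x \<in> carrier X" "d \<in> carrier X" "n \<in> carrier X" for x d n
  proof -
    have "(x \<otimes> d \<otimes> inv x) \<otimes> (x \<otimes> n \<otimes> inv x) = x \<otimes> d \<otimes> (inv x \<otimes> x) \<otimes> n \<otimes> inv x"
      using that by (simp only: X.m_assoc X.m_closed X.inv_closed)
    then show ?thesis
      using that by (simp add: X.m_assoc)
  qed
  have cancel: "inv a \<otimes> (a \<otimes> b) = b" if "a \<in> carrier X" "b \<in> carrier X" for a b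
    using that by (simp add: X.m_assoc[symmetric])
  \<comment> \<open>With \<open>w = d \<otimes> n\<close>, the conjugate of \<open>d\<close> stays
    in the normal subgroup \<open>D\<close>. The conjugate of \<open>n\<close> lies in
    \<open>N\<close> and so avoids \<open>Q\<close>, which forces it into \<open>DU\<close>.\<close>
  have Wgen: "m \<otimes> w \<otimes> inv m \<in> W" if m: "m \<in> M" "m \<in> S'" and w: "w \<in> W" for m w
  proof -
    have mN: "m \<otimes> w \<otimes> inv m \<in> N"
      using Nconj[OF m(1)] w unfolding W_def by blast
    have "w \<in> D <#> U"
      using w unfolding W_def DU_def by blast
    then obtain d n where dn: "d \<in> D" "n \<in> U" "w = d \<otimes> n"
      unfolding set_mult_def by blast
    have c: "m \<in> carrier X" "d \<in> carrier X" "n \<in> carrier X"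
      using carr m dn by auto
    have eq: "m \<otimes> w \<otimes> inv m = (m \<otimes> d \<otimes> inv m) \<otimes> (m \<otimes> n \<otimes> inv m)"
      unfolding dn(3) by (rule split[OF c])
    have d': "m \<otimes> d \<otimes> inv m \<in> D"
      by (rule Dconj[OF c(1) dn(1)])
    have "m \<otimes> n \<otimes> inv m = inv (m \<otimes> d \<otimes> inv m) \<otimes> (m \<otimes> w \<otimes> inv m)"
      unfolding eq using c by (intro cancel[symmetric]) simp_all
    also have "\<dots> \<in> N"
      by (rule subgroup.m_closed[OF N subgroup.m_inv_closed[OF N subsetD[OF DN d']] mN])
    finally have nN: "m \<otimes> n \<otimes> inv m \<in> N" .
    have "m \<otimes> n \<otimes> inv m \<in> S' <#> U <#> set_inv S'"
      unfolding set_mult_def SET_INV_def using m(2) dn(2) by blast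
    then have "m \<otimes> n \<otimes> inv m \<in> DU"
      using nN NQ unfolding Q_def by blast
    then have "m \<otimes> w \<otimes> inv m \<in> DU"
      unfolding eq by (rule subgroup.m_closed[OF DU D_DU[OF d']])
    then show ?thesis
      unfolding W_def using mN by blast
  qed
  \<comment> \<open>The normaliser of \<open>W\<close>; the condition on \<open>inv x\<close> builds
    in closure under inversion.\<close>
  define Z where "Z = {x \<in> carrier X. \<forall>w\<in>W. x \<otimes> w \<otimes> inv x \<in> W \<and> inv x \<otimes> w \<otimes> inv (inv x) \<in> W}"
  have Z: "subgroup Z X"
  proof (rule X.subgroupI)
    show "Z \<subseteq> carrier X"
      unfolding Z_def by blast
    have "\<one> \<in> Z"
      unfolding Z_def using Wc by simp
    then show "Z \<noteq> {}"
      by blast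
    show "inv a \<in> Z" if "a \<in> Z" for a
      using that unfolding Z_def by auto
    show "a \<otimes> b \<in> Z" if ab: "a \<in> Z" "b \<in> Z" for a b
    proof -
      have c: "a \<in> carrier X" "b \<in> carrier X"
        using ab unfolding Z_def by auto
      have "a \<otimes> b \<otimes> w \<otimes> inv (a \<otimes> b) \<in> W \<and> inv (a \<otimes> b) \<otimes> w \<otimes> inv (inv (a \<otimes> b)) \<in> W"
        if w: "w \<in> W" for w
      proof
        have "a \<otimes> (b \<otimes> w \<otimes> inv b) \<otimes> inv a \<in> W"
          using ab w unfolding Z_def by blast
        then show "a \<otimes> b \<otimes> w \<otimes> inv (a \<otimes> b) \<in> W"
          using c Wc[OF w] by (simp add: X.inv_mult_group X.m_assoc)
        have "inv b \<otimes> (inv a \<otimes> w \<otimes> inv (inv a)) \<otimes> inv (inv b) \<in> W"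
          using ab w unfolding Z_def by blast
        then show "inv (a \<otimes> b) \<otimes> w \<otimes> inv (inv (a \<otimes> b)) \<in> W"
          using c Wc[OF w] by (simp add: X.inv_mult_group X.m_assoc)
      qed
      then show ?thesis
        unfolding Z_def using c by simp
    qed
  qed
  have "M \<inter> S \<subseteq> Z"
  proof
    fix m assume m: "m \<in> M \<inter> S"
    then have mM: "m \<in> M" "m \<in> S'" "inv m \<in> S'"
      unfolding S'_def SET_INV_def by blast+
    have mM': "inv m \<in> M"
      by (rule subgroup.m_inv_closed[OF M mM(1)])
    show "m \<in> Z"
      unfolding Z_def using carr(2)[OF mM(1)] Wgen[OF mM(1,2)] Wgen[OF mM' mM(3)] by simp
  qed
  then have MZ: "M \<subseteq> Z"
    using X.generate_subgroup_incl[OF _ Z] S(2) by blast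
  have ndW: "\<not> discrete_in TX W"
  proof
    assume "discrete_in TX W"
    moreover have "N \<inter> U \<subseteq> W"
      unfolding W_def using U_DU by blast
    ultimately have "discrete_in TX (N \<inter> U)"
      by (rule X.discrete_in_subset)
    then show False
      using X.discrete_if_Int_open_subgroup_discrete[OF N U(1,2)] ndN by simp
  qed
  \<comment> \<open>An open, hence closed, subgroup that will contain all conjugates of
    \<open>W\<close>.\<close>
  define P where "P = D <#> L"
  have P: "subgroup P X"
    unfolding P_def by (rule X.mult_norm_subgroup[OF D(1) L(1)])
  have "L \<subseteq> P"
  proof
    fix l assume l: "l \<in> L"
    then have "l = \<one> \<otimes> l"
      using subgroup.mem_carrier[OF L(1) l] by simp
    then show "l \<in> P"
      unfolding P_def set_mult_def using l subgroup.one_closed[OF sD] by blast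
  qed
  then have "openin TX P"
    by (rule X.subgroup_openin[OF P L(2) subgroup.one_closed[OF L(1)]])
  then have cP: "closedin TX P"
    by (rule X.open_subgroup_closed[OF P])
  have conj: "x \<otimes> w \<otimes> inv x \<in> P" if x: "x \<in> carrier X" and w: "w \<in> W" for x w
  proof -
    obtain m k where mk: "m \<in> M" "k \<in> K" "inv x = m \<otimes> k"
      using K(2)[of "inv x"] x by auto
    have kc: "k \<in> carrier X"
      using subsetD[OF X.compact_subset_carrier[OF K(1)] mk(2)] .
    have mc: "m \<in> carrier X"
      by (rule carr(2)[OF mk(1)])
    \<comment> \<open>In this factorisation, conjugation by \<open>inv m\<close> keeps
      \<open>w\<close> in \<open>W \<subseteq> DU\<close>; conjugation by \<open>inv k\<close> then
      keeps the \<open>D\<close>-part in \<open>D\<close> and moves the \<open>U\<close>-part into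
      \<open>L\<close>.\<close>
    have x_eq: "x = inv k \<otimes> inv m"
      using arg_cong[OF mk(3), of "\<lambda>z. inv z"] x kc mc by (simp add: X.inv_mult_group)
    define w' where "w' = inv m \<otimes> w \<otimes> inv (inv m)"
    have "m \<in> Z"
      using MZ mk(1) by (rule subsetD)
    then have w': "w' \<in> W"
      unfolding w'_def Z_def using w by blast
    have "x \<otimes> w \<otimes> inv x = inv k \<otimes> w' \<otimes> inv (inv k)"
      unfolding w'_def x_eq using kc mc Wc[OF w] by (simp add: X.inv_mult_group X.m_assoc)
    moreover obtain d n where dn: "d \<in> D" "n \<in> U" "w' = d \<otimes> n"
      using w' unfolding W_def DU_def set_mult_def by blast
    moreover have kc': "inv k \<in> carrier X" and dc: "d \<in> carrier X" and nc: "n \<in> carrier X"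
      using kc carr dn by auto
    ultimately have "x \<otimes> w \<otimes> inv x = (inv k \<otimes> d \<otimes> inv (inv k)) \<otimes> (inv k \<otimes> n \<otimes> inv (inv k))"
      using split[OF kc' dc nc] by simp
    moreover have "inv k \<otimes> d \<otimes> inv (inv k) \<in> D"
      by (rule Dconj[OF kc' dn(1)])
    moreover have "inv k \<in> set_inv K"
      unfolding SET_INV_def using mk(2) by blast
    then have "inv k \<otimes> n \<otimes> inv (inv k) \<in> L"
      using U'(3) subsetD[OF U(4) dn(2)] by simp
    ultimately show ?thesis
      unfolding P_def set_mult_def by blast
  qed
  have PL: "P \<subseteq> D <#> L"
    by (simp add: P_def)
  \<comment> \<open>The discrete normal subgroup \<open>D\<close> becomes cocompact, which is
    impossible in \<open>X\<close>.\<close>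
  obtain R where R: "compactin TX R" "\<And>g. g \<in> carrier X \<Longrightarrow> \<exists>d\<in>D. \<exists>k\<in>R. g = d \<otimes> k"
    using X.cocompact_if_contains_conjugates[OF qjnc(1) subgroup.subset[OF W] ndW P cP PL
        subgroup.subset[OF sD] L(3) conj] by blast
  then show False
    using X.cocompact_normal_nondiscrete[OF qjnc(1) cg ndX D(1)] dD by blast
qed

end

subsection \<open>Lattices in a product of three groups\<close>

text \<open>The preimage of a neighbourhood isolating \<open>f s\<close> in \<open>R\<close>
  isolates \<open>s\<close> in \<open>S\<close>. Discreteness is transported in this way along
  coordinate embeddings.\<close>

lemma discrete_in_vimage:
  assumes d: "discrete_in Y R" and f: "continuous_map X Y f"
    and S: "S \<subseteq> topspace X" "inj_on f S" "f ` S \<subseteq> R"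
  shows "discrete_in X S"
proof -
  have "openin (subtopology X S) {s}" if s: "s \<in> S" for s
  proof -
    have "openin (subtopology Y R) {f s}"
      using d S(3) s unfolding discrete_in_def by auto
    then obtain U where U: "openin Y U" "{f s} = U \<inter> R"
      unfolding openin_subtopology by blast
    have "openin X {x \<in> topspace X. f x \<in> U}"
      by (rule openin_continuous_map_preimage[OF f U(1)])
    moreover have "{s} = {x \<in> topspace X. f x \<in> U} \<inter> S"
    proof (intro equalityI subsetI)
      fix x assume x: "x \<in> {x \<in> topspace X. f x \<in> U} \<inter> S"
      then have "f x \<in> U \<inter> R"
        using S(3) by blast
      then have "f x = f s"
        using U(2) by blast
      then show "x \<in> {s}"
        using inj_onD[OF S(2)] x s by blast
    qed (use U(2) s S(1) in auto)
    ultimately show ?thesis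
      unfolding openin_subtopology by blast
  qed
  then show ?thesis
    unfolding discrete_in_def using S(1)
    by (subst eq_commute, subst discrete_topology_unique) (simp add: Int_absorb1)
qed

lemma topological_group_product_group:
  assumes "\<And>i. i \<in> I \<Longrightarrow> topological_group (G i) (T i)"
  shows "topological_group (product_group I G) (product_topology T I)"
proof -
  have gr: "group (G i)" if "i \<in> I" for i
    using assms[OF that] by (simp add: topological_group_def)
  interpret group "product_group I G"
    by (rule product_group[OF gr])
  have top: "topspace (product_topology T I) = (\<Pi>\<^sub>E i\<in>I. carrier (G i))"
    unfolding topspace_product_topology
    by (intro PiE_cong topological_group.topspace_eq[OF assms])
  let ?P = "product_topology T I"
  show ?thesis
  proof
    show "topspace ?P = carrier (product_group I G)"
      using top by simp
    have "continuous_map (prod_topology ?P ?P) (T i) (\<lambda>p. fst p i \<otimes>\<^bsub>G i\<^esub> snd p i)" if i: "i \<in> I" for i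
      by (intro topological_group.continuous_map_group_mult[OF assms[OF i]]
          continuous_map_compose[OF continuous_map_fst continuous_map_product_projection[OF i], unfolded o_def]
          continuous_map_compose[OF continuous_map_snd continuous_map_product_projection[OF i], unfolded o_def])
    then have "continuous_map (prod_topology ?P ?P) ?P (\<lambda>p. \<lambda>i\<in>I. fst p i \<otimes>\<^bsub>G i\<^esub> snd p i)"
      by (auto simp: continuous_map_componentwise)
    then show "continuous_map (prod_topology ?P ?P) ?P (\<lambda>(x, y). x \<otimes>\<^bsub>product_group I G\<^esub> y)"
      by (simp add: case_prod_unfold)
    have "continuous_map ?P (T i) (\<lambda>p. inv\<^bsub>G i\<^esub> p i)" if i: "i \<in> I" for i
      by (intro topological_group.continuous_map_group_inv[OF assms[OF i]]
          continuous_map_product_projection[OF i])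
    then have "continuous_map ?P ?P (\<lambda>p. \<lambda>i\<in>I. inv\<^bsub>G i\<^esub> p i)"
      by (auto simp: continuous_map_componentwise)
    then show "continuous_map ?P ?P (\<lambda>p. inv\<^bsub>product_group I G\<^esub> p)"
    proof (rule continuous_map_eq)
      fix p assume "p \<in> topspace ?P"
      then show "(\<lambda>i\<in>I. inv\<^bsub>G i\<^esub> p i) = inv\<^bsub>product_group I G\<^esub> p"
        using inv_product_group[of p I G] gr unfolding top by simp
    qed
  qed
qed

text \<open>The hypotheses are put on an abstract index set of three elements, so that the arguments
  can treat the indices symmetrically.\<close>

locale product_lattice =
  fixes I :: "'i set" and G :: "'i \<Rightarrow> 'a monoid" and T :: "'i \<Rightarrow> 'a topology" and \<Gamma> :: "('i \<Rightarrow> 'a) set"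
  assumes card_I: "card I = 3"
    and tdlc: "i \<in> I \<Longrightarrow> tdlc_group (G i) (T i)"
    and nondiscrete: "i \<in> I \<Longrightarrow> \<not> discrete_in (T i) (carrier (G i))"
    and cg: "i \<in> I \<Longrightarrow> compactly_generated (G i) (T i)"
    and qjnc: "i \<in> I \<Longrightarrow> quasi_just_non_compact (G i) (T i)"
    and lattice: "cocompact_lattice (product_group I G) (product_topology T I) \<Gamma>"
    and dense: "i \<in> I \<Longrightarrow> T i closure_of ((\<lambda>x. x i) ` \<Gamma>) = carrier (G i)"
begin

lemma finite_I: "finite I"
  using card_I card.infinite by fastforce

lemma topological_group: "i \<in> I \<Longrightarrow> topological_group (G i) (T i)"
  using tdlc tdlc_group.axioms(1) by blast

lemma group: "i \<in> I \<Longrightarrow> group (G i)"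
  using topological_group by (simp add: topological_group_def)

sublocale P: topological_group "product_group I G" "product_topology T I"
  by (rule topological_group_product_group[OF topological_group])

lemma \<Gamma>_subgroup: "subgroup \<Gamma> (product_group I G)"
  and \<Gamma>_discrete: "discrete_in (product_topology T I) \<Gamma>"
  using lattice by (auto simp: cocompact_lattice_def)

lemma \<Gamma>_carrier: "x \<in> \<Gamma> \<Longrightarrow> i \<in> I \<Longrightarrow> x i \<in> carrier (G i)"
  using subgroup.mem_carrier[OF \<Gamma>_subgroup, of x] by auto

lemma \<Gamma>_one: "(\<lambda>i\<in>I. \<one>\<^bsub>G i\<^esub>) \<in> \<Gamma>"
  using subgroup.one_closed[OF \<Gamma>_subgroup] by simp

lemma \<Gamma>_mult: "x \<in> \<Gamma> \<Longrightarrow> y \<in> \<Gamma> \<Longrightarrow> (\<lambda>i\<in>I. x i \<otimes>\<^bsub>G i\<^esub> y i) \<in> \<Gamma>"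
  using subgroup.m_closed[OF \<Gamma>_subgroup, of x y] by simp

lemma \<Gamma>_inv:
  assumes "x \<in> \<Gamma>"
  shows "(\<lambda>i\<in>I. inv\<^bsub>G i\<^esub> x i) \<in> \<Gamma>"
proof -
  have "x \<in> (\<Pi>\<^sub>E i\<in>I. carrier (G i))"
    using subgroup.mem_carrier[OF \<Gamma>_subgroup assms] by simp
  then show ?thesis
    using subgroup.m_inv_closed[OF \<Gamma>_subgroup assms] inv_product_group[of x I G] group by simp
qed

lemma compact_transversal:
  obtains C where "compactin (product_topology T I) C"
    "\<And>x. x \<in> carrier (product_group I G) \<Longrightarrow> \<exists>h\<in>\<Gamma>. \<exists>c\<in>C. x = h \<otimes>\<^bsub>product_group I G\<^esub> c"
proof -
  have "locally_compact_space (product_topology T I)"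
    unfolding locally_compact_space_product_topology
    using finite_I tdlc tdlc_group.locally_compact by auto
  moreover have "cocompact (product_group I G) (product_topology T I) \<Gamma>"
    using lattice by (simp add: cocompact_lattice_def)
  ultimately show ?thesis
    using P.cocompact_imp_compact_transversal[OF _ \<Gamma>_subgroup] that by blast
qed

subsubsection \<open>The intersection of the lattice with a factor\<close>

definition embed :: "'i \<Rightarrow> 'a \<Rightarrow> 'i \<Rightarrow> 'a" where
  "embed k a = (\<lambda>i\<in>I. if i = k then a else \<one>\<^bsub>G i\<^esub>)"

text \<open>The group \<open>\<Gamma> \<inter> G\<^sub>k\<close>, regarded as a subset of
  \<open>G k\<close>.\<close>

definition axis :: "'i \<Rightarrow> 'a set" where
  "axis k = {a \<in> carrier (G k). embed k a \<in> \<Gamma>}"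

lemma continuous_map_embed:
  assumes "k \<in> I"
  shows "continuous_map (T k) (product_topology T I) (embed k)"
proof -
  have "continuous_map (T k) (T i) (\<lambda>a. if i = k then a else \<one>\<^bsub>G i\<^esub>)" if "i \<in> I" for i
    using topological_group.topspace_eq[OF topological_group[OF that]] monoid.one_closed
      group.is_monoid[OF group[OF that]]
    by (cases "i = k") auto
  then show ?thesis
    unfolding embed_def by (auto simp: continuous_map_componentwise)
qed

lemma embed_mult:
  assumes "k \<in> I"
  shows "(\<lambda>i\<in>I. embed k a i \<otimes>\<^bsub>G i\<^esub> embed k b i) = embed k (a \<otimes>\<^bsub>G k\<^esub> b)"
  using group group.is_monoid monoid.l_one[OF group.is_monoid[OF group] monoid.one_closed[OF group.is_monoid[OF group]]]
  by (auto simp: embed_def fun_eq_iff)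

lemma embed_inv: "k \<in> I \<Longrightarrow> (\<lambda>i\<in>I. inv\<^bsub>G i\<^esub> embed k a i) = embed k (inv\<^bsub>G k\<^esub> a)"
  using monoid.inv_one[OF group.is_monoid[OF group]]
  by (auto simp: embed_def fun_eq_iff)

lemma subgroup_axis:
  assumes k: "k \<in> I"
  shows "subgroup (axis k) (G k)"
proof -
  interpret group "G k"
    by (rule group[OF k])
  show ?thesis
  proof (rule subgroupI)
    have "embed k \<one>\<^bsub>G k\<^esub> = (\<lambda>i\<in>I. \<one>\<^bsub>G i\<^esub>)"
      by (auto simp: embed_def fun_eq_iff)
    then have "\<one>\<^bsub>G k\<^esub> \<in> axis k"
      unfolding axis_def using \<Gamma>_one by simp
    then show "axis k \<noteq> {}"
      by blast
    show "inv\<^bsub>G k\<^esub> a \<in> axis k" if "a \<in> axis k" for a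
      using that \<Gamma>_inv[of "embed k a"] unfolding axis_def embed_inv[OF k] by simp
    show "a \<otimes>\<^bsub>G k\<^esub> b \<in> axis k" if "a \<in> axis k" "b \<in> axis k" for a b
      using that \<Gamma>_mult[of "embed k a" "embed k b"] unfolding axis_def embed_mult[OF k] by simp
  qed (auto simp: axis_def)
qed

lemma discrete_axis:
  assumes k: "k \<in> I"
  shows "discrete_in (T k) (axis k)"
proof (rule discrete_in_vimage[OF \<Gamma>_discrete continuous_map_embed[OF k]])
  show "axis k \<subseteq> topspace (T k)"
    using topological_group.topspace_eq[OF topological_group[OF k]] by (auto simp: axis_def)
  show "inj_on (embed k) (axis k)"
    using k by (auto simp: inj_on_def embed_def fun_eq_iff split: if_splits)
  show "embed k ` axis k \<subseteq> \<Gamma>"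
    by (auto simp: axis_def)
qed

text \<open>Conjugation by \<open>x \<in> \<Gamma>\<close> preserves both \<open>\<Gamma>\<close>
  and the factor, and on the factor it is conjugation by \<open>x k\<close>. These
  \<open>x k\<close> are dense, and the discrete subgroup \<open>axis k\<close> is closed.\<close>

lemma normal_axis:
  assumes k: "k \<in> I"
  shows "axis k \<lhd> G k"
proof -
  interpret tdlc_group "G k" "T k"
    by (rule tdlc[OF k])
  show ?thesis
  proof (rule normal_if_dense_normaliser[OF subgroup_axis[OF k] _ dense[OF k]])
    show "closedin (T k) (axis k)"
      by (rule discrete_subgroup_closed[OF subgroup_axis[OF k] discrete_axis[OF k]])
    fix d n assume d: "d \<in> (\<lambda>x. x k) ` \<Gamma>" "d \<in> carrier (G k)" and n: "n \<in> axis k"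
    then obtain x where x: "x \<in> \<Gamma>" "d = x k"
      by blast
    have nc: "n \<in> carrier (G k)" "embed k n \<in> \<Gamma>"
      using n by (auto simp: axis_def)
    have "(\<lambda>i\<in>I. (\<lambda>i\<in>I. x i \<otimes>\<^bsub>G i\<^esub> embed k n i) i \<otimes>\<^bsub>G i\<^esub> (\<lambda>i\<in>I. inv\<^bsub>G i\<^esub> x i) i) \<in> \<Gamma>"
      by (intro \<Gamma>_mult \<Gamma>_inv x(1) nc(2))
    also have "(\<lambda>i\<in>I. (\<lambda>i\<in>I. x i \<otimes>\<^bsub>G i\<^esub> embed k n i) i \<otimes>\<^bsub>G i\<^esub> (\<lambda>i\<in>I. inv\<^bsub>G i\<^esub> x i) i)
        = embed k (d \<otimes>\<^bsub>G k\<^esub> n \<otimes>\<^bsub>G k\<^esub> inv\<^bsub>G k\<^esub> d)"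
    proof
      fix i
      show "(\<lambda>i\<in>I. (\<lambda>i\<in>I. x i \<otimes>\<^bsub>G i\<^esub> embed k n i) i \<otimes>\<^bsub>G i\<^esub> (\<lambda>i\<in>I. inv\<^bsub>G i\<^esub> x i) i) i
        = embed k (d \<otimes>\<^bsub>G k\<^esub> n \<otimes>\<^bsub>G k\<^esub> inv\<^bsub>G k\<^esub> d) i"
        using x(2) monoid.r_one[OF group.is_monoid[OF group] \<Gamma>_carrier[OF x(1)], of i]
          group.r_inv[OF group \<Gamma>_carrier[OF x(1)], of i]
        by (auto simp: embed_def)
    qed
    finally show "d \<otimes>\<^bsub>G k\<^esub> n \<otimes>\<^bsub>G k\<^esub> inv\<^bsub>G k\<^esub> d \<in> axis k"
      unfolding axis_def using d(2) nc(1) by simp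
  qed
qed

subsubsection \<open>Projections to one factor\<close>

text \<open>Otherwise density would make \<open>G k\<close> discrete. Right cosets appear because
  they define the index in (Irr0).\<close>

lemma \<Gamma>_proj_not_in_finite_Union_cosets:
  assumes k: "k \<in> I" and D: "subgroup D (G k)" "discrete_in (T k) D"
    and F: "finite F" "F \<subseteq> \<Gamma>"
  shows "\<not> (\<forall>x\<in>\<Gamma>. \<exists>f\<in>F. \<exists>d\<in>D. x k = d \<otimes>\<^bsub>G k\<^esub> f k)"
proof
  assume cov: "\<forall>x\<in>\<Gamma>. \<exists>f\<in>F. \<exists>d\<in>D. x k = d \<otimes>\<^bsub>G k\<^esub> f k"
  interpret tdlc_group "G k" "T k"
    by (rule tdlc[OF k])
  have "(\<lambda>x. x k) ` \<Gamma> \<subseteq> (\<Union>g\<in>(\<lambda>f. inv\<^bsub>G k\<^esub> f k) ` F. g <#\<^bsub>G k\<^esub> D)"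
  proof
    fix a assume "a \<in> (\<lambda>x. x k) ` \<Gamma>"
    then obtain x where x: "x \<in> \<Gamma>" "a = x k"
      by blast
    \<comment> \<open>The covering is applied to the inverse of \<open>x\<close>: inversion turns
      right cosets of \<open>D\<close> into left cosets, for which the density argument is
      stated.\<close>
    obtain f d where fd: "f \<in> F" "d \<in> D" "(\<lambda>i\<in>I. inv\<^bsub>G i\<^esub> x i) k = d \<otimes>\<^bsub>G k\<^esub> f k"
      using cov \<Gamma>_inv[OF x(1)] by blast
    have c: "a \<in> carrier (G k)" "d \<in> carrier (G k)" "f k \<in> carrier (G k)"
      using \<Gamma>_carrier[OF x(1) k] x(2) subgroup.mem_carrier[OF D(1) fd(2)] \<Gamma>_carrier[OF subsetD[OF F(2) fd(1)] k]
      by auto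
    have "inv\<^bsub>G k\<^esub> a = d \<otimes>\<^bsub>G k\<^esub> f k"
      using fd(3) k x(2) by simp
    then have "inv\<^bsub>G k\<^esub> (inv\<^bsub>G k\<^esub> a) = inv\<^bsub>G k\<^esub> (d \<otimes>\<^bsub>G k\<^esub> f k)"
      by (simp only:)
    then have "a = inv\<^bsub>G k\<^esub> f k \<otimes>\<^bsub>G k\<^esub> inv\<^bsub>G k\<^esub> d"
      using c by (simp add: inv_mult_group)
    then have "a \<in> (inv\<^bsub>G k\<^esub> f k) <#\<^bsub>G k\<^esub> D"
      unfolding l_coset_def using subgroup.m_inv_closed[OF D(1) fd(2)] by blast
    then show "a \<in> (\<Union>g\<in>(\<lambda>f. inv\<^bsub>G k\<^esub> f k) ` F. g <#\<^bsub>G k\<^esub> D)"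
      using fd(1) by blast
  qed
  then have "(\<lambda>x. x k) ` \<Gamma> \<inter> carrier (G k) \<subseteq> (\<Union>g\<in>(\<lambda>f. inv\<^bsub>G k\<^esub> f k) ` F. g <#\<^bsub>G k\<^esub> D)"
    by (rule le_infI1)
  moreover have "finite ((\<lambda>f. inv\<^bsub>G k\<^esub> f k) ` F)"
    using F(1) by simp
  moreover have "(\<lambda>f. inv\<^bsub>G k\<^esub> f k) ` F \<subseteq> carrier (G k)"
    using \<Gamma>_carrier[OF subsetD[OF F(2)] k] by auto
  ultimately have "discrete_in (T k) (carrier (G k))"
    using discrete_if_dense_subset_finite_Union_cosets[OF D _ _ dense[OF k]] by simp
  then show False
    using nondiscrete[OF k] by contradiction
qed

lemma subgroup_hom_image:
  assumes "group K" "\<phi> \<in> hom (product_group I G) K"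
  shows "subgroup (\<phi> ` \<Gamma>) K"
proof -
  interpret group_hom "product_group I G" K \<phi>
    using assms P.group_axioms by (simp add: group_hom_def group_hom_axioms_def)
  show ?thesis
    by (rule subgroup_img_is_subgroup[OF \<Gamma>_subgroup])
qed

lemma subgroup_proj1:
  assumes k: "k \<in> I"
  shows "subgroup ((\<lambda>x. x k) ` \<Gamma>) (G k)"
  by (rule subgroup_hom_image[OF group[OF k]]) (use k in \<open>auto simp: hom_def\<close>)

text \<open>A discrete image would be covered by one coset of a discrete subgroup, namely
  itself.\<close>

lemma proj1_nondiscrete:
  assumes k: "k \<in> I"
  shows "\<not> discrete_in (T k) ((\<lambda>x. x k) ` \<Gamma>)"
proof
  assume d: "discrete_in (T k) ((\<lambda>x. x k) ` \<Gamma>)"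
  interpret group "G k"
    by (rule group[OF k])
  have "\<forall>x\<in>\<Gamma>. \<exists>f\<in>{\<lambda>i\<in>I. \<one>\<^bsub>G i\<^esub>}. \<exists>d\<in>(\<lambda>x. x k) ` \<Gamma>. x k = d \<otimes>\<^bsub>G k\<^esub> f k"
    using k \<Gamma>_carrier by auto
  then show False
    using \<Gamma>_proj_not_in_finite_Union_cosets[OF k subgroup_proj1[OF k] d, of "{\<lambda>i\<in>I. \<one>\<^bsub>G i\<^esub>}"] \<Gamma>_one
    by blast
qed

lemma Irr0: "Irr0 I G \<Gamma>"
  unfolding Irr0_def
proof (intro allI impI, elim conjE)
  fix \<Sigma>' \<Sigma> assume part: "\<Sigma>' \<union> \<Sigma> = I" "\<Sigma>' \<inter> \<Sigma> = {}" "\<Sigma>' \<noteq> {}" "\<Sigma> \<noteq> {}"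
  let ?A = "subproduct I G \<Sigma>' \<inter> \<Gamma>" and ?B = "subproduct I G \<Sigma> \<inter> \<Gamma>"
  let ?H = "?A <#>\<^bsub>product_group I G\<^esub> ?B"
  let ?G\<Gamma> = "product_group I G\<lparr>carrier := \<Gamma>\<rparr>"
  have fin: "finite \<Sigma>" "finite \<Sigma>'"
    using part(1) finite_I by (auto intro: finite_subset)
  then have "card \<Sigma>' + card \<Sigma> = 3"
    using card_Un_disjoint[of \<Sigma>' \<Sigma>] part card_I by simp
  moreover have "card \<Sigma>' \<noteq> 0" "card \<Sigma> \<noteq> 0"
    using fin part by auto
  ultimately have "card \<Sigma> = 1 \<or> card \<Sigma>' = 1"
    by linarith
  then obtain k where k: "\<Sigma> = {k} \<or> \<Sigma>' = {k}"
    using card_1_singletonE by metis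
  then have kI: "k \<in> I"
    using part(1) by blast
  interpret Gk: group "G k"
    by (rule group[OF kI])
  have sub_axis: "b k \<in> axis k" if "b \<in> subproduct I G {k} \<inter> \<Gamma>" for b
  proof -
    have b: "b \<in> (\<Pi>\<^sub>E i\<in>I. carrier (G i))" "\<And>i. i \<in> I \<Longrightarrow> i \<noteq> k \<Longrightarrow> b i = \<one>\<^bsub>G i\<^esub>" "b \<in> \<Gamma>"
      using that unfolding subproduct_def by auto
    have "embed k (b k) = b"
      using b(1,2) by (auto simp: embed_def fun_eq_iff PiE_iff extensional_def)
    then show ?thesis
      unfolding axis_def using b(3) \<Gamma>_carrier[OF b(3) kI] by simp
  qed
  have sub_one: "b k = \<one>\<^bsub>G k\<^esub>" if "b \<in> subproduct I G \<Theta> \<inter> \<Gamma>" "k \<notin> \<Theta>" for b \<Theta>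
    using that kI unfolding subproduct_def by auto
  \<comment> \<open>One of the two factors has trivial \<open>k\<close>-coordinate, and the other
    lies in \<open>\<Gamma> \<inter> G\<^sub>k\<close>.\<close>
  have H_axis: "(\<lambda>i\<in>I. a i \<otimes>\<^bsub>G i\<^esub> b i) k \<in> axis k" if ab: "a \<in> ?A" "b \<in> ?B" for a b
    using k
  proof
    assume "\<Sigma> = {k}"
    then have "a k = \<one>\<^bsub>G k\<^esub>" "b k \<in> axis k"
      using sub_one[OF ab(1)] sub_axis[of b] ab(2) part(2) by auto
    then show ?thesis
      using kI by (simp add: axis_def)
  next
    assume "\<Sigma>' = {k}"
    then have "b k = \<one>\<^bsub>G k\<^esub>" "a k \<in> axis k"
      using sub_one[OF ab(2)] sub_axis[of a] ab(1) part(2) by auto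
    then show ?thesis
      using kI by (simp add: axis_def)
  qed
  have one: "(\<lambda>i\<in>I. \<one>\<^bsub>G i\<^esub>) \<in> ?A" "(\<lambda>i\<in>I. \<one>\<^bsub>G i\<^esub>) \<in> ?B"
    using \<Gamma>_one group group.is_monoid monoid.one_closed unfolding subproduct_def by fastforce+
  show "infinite_index (product_group I G) \<Gamma> ?H"
    unfolding infinite_index_def
  proof
    assume "finite (rcosets\<^bsub>?G\<Gamma>\<^esub> ?H)"
    then have "finite ((\<lambda>g. ?H #>\<^bsub>?G\<Gamma>\<^esub> g) ` \<Gamma>)"
      by (simp add: RCOSETS_def UNION_singleton_eq_range)
    \<comment> \<open>Representatives of the finitely many cosets. Comparing
      \<open>k\<close>-coordinates then covers the projection to \<open>G k\<close> by finitely many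
      cosets of \<open>axis k\<close>.\<close>
    then obtain F where F: "finite F" "F \<subseteq> \<Gamma>"
      "(\<lambda>g. ?H #>\<^bsub>?G\<Gamma>\<^esub> g) ` \<Gamma> = (\<lambda>g. ?H #>\<^bsub>?G\<Gamma>\<^esub> g) ` F"
      using finite_subset_image[of "(\<lambda>g. ?H #>\<^bsub>?G\<Gamma>\<^esub> g) ` \<Gamma>" "\<lambda>g. ?H #>\<^bsub>?G\<Gamma>\<^esub> g" \<Gamma>] by blast
    have "\<exists>f\<in>F. \<exists>d\<in>axis k. x k = d \<otimes>\<^bsub>G k\<^esub> f k" if x: "x \<in> \<Gamma>" for x
    proof -
      have xc: "x \<in> carrier (product_group I G)"
        by (rule subgroup.mem_carrier[OF \<Gamma>_subgroup x])
      have "\<one>\<^bsub>product_group I G\<^esub> \<otimes>\<^bsub>product_group I G\<^esub> \<one>\<^bsub>product_group I G\<^esub> \<in> ?H"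
        unfolding set_mult_def one_product_group using one by blast
      then have "\<one>\<^bsub>product_group I G\<^esub> \<in> ?H"
        by (simp only: P.r_one P.one_closed)
      moreover have "\<one>\<^bsub>product_group I G\<^esub> \<otimes>\<^bsub>?G\<Gamma>\<^esub> x = x"
        using P.l_one[OF xc] by (simp del: mult_product_group one_product_group)
      ultimately have "x \<in> ?H #>\<^bsub>?G\<Gamma>\<^esub> x"
        unfolding r_coset_def by (metis UN_I singletonI)
      moreover obtain f where f: "f \<in> F" "?H #>\<^bsub>?G\<Gamma>\<^esub> x = ?H #>\<^bsub>?G\<Gamma>\<^esub> f"
        using F(3) x by blast
      ultimately have "x \<in> ?H #>\<^bsub>?G\<Gamma>\<^esub> f"
        by simp
      then obtain h where h: "h \<in> ?H" "x = h \<otimes>\<^bsub>?G\<Gamma>\<^esub> f"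
        unfolding r_coset_def by blast
      obtain a b where ab: "a \<in> ?A" "b \<in> ?B" "h = a \<otimes>\<^bsub>product_group I G\<^esub> b"
        using h(1) unfolding set_mult_def by blast
      have "x k = (\<lambda>i\<in>I. a i \<otimes>\<^bsub>G i\<^esub> b i) k \<otimes>\<^bsub>G k\<^esub> f k"
        using kI unfolding h(2) ab(3) by simp
      then show ?thesis
        using H_axis[OF ab(1,2)] f(1) by blast
    qed
    then show False
      using \<Gamma>_proj_not_in_finite_Union_cosets[OF kI subgroup_axis[OF kI] discrete_axis[OF kI] F(1,2)] by blast
  qed
qed

subsubsection \<open>Projections to two factors\<close>

lemma third_index:
  assumes "i \<in> I" "j \<in> I" "i \<noteq> j"
  obtains k where "k \<in> I" "k \<noteq> i" "k \<noteq> j" "I = {i, j, k}"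
proof -
  obtain a b c where "I = {a, b, c}" "a \<noteq> b" "b \<noteq> c" "a \<noteq> c"
    using card_I unfolding card_3_iff by blast
  then have "\<exists>k. k \<in> I \<and> k \<noteq> i \<and> k \<noteq> j \<and> I = {i, j, k}"
    using assms by auto
  then show ?thesis
    using that by blast
qed

lemma tdlc_pair: "i \<in> I \<Longrightarrow> j \<in> I \<Longrightarrow> tdlc_group_pair (G i) (T i) (G j) (T j)"
  using tdlc by (simp add: tdlc_group_pair_def)

text \<open>Pairs are used instead of functions on \<open>{i, j}\<close>, so that the results on
  products of two groups apply.\<close>

definition pair_proj :: "'i \<Rightarrow> 'i \<Rightarrow> ('a \<times> 'a) set" where
  "pair_proj i j = (\<lambda>x. (x i, x j)) ` \<Gamma>"

lemma subgroup_pair_proj: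
  assumes "i \<in> I" "j \<in> I"
  shows "subgroup (pair_proj i j) (G i \<times>\<times> G j)"
  unfolding pair_proj_def
  by (rule subgroup_hom_image[OF DirProd_group[OF group[OF assms(1)] group[OF assms(2)]]])
    (use assms in \<open>auto simp: hom_def\<close>)

text \<open>Discreteness would give open subgroups \<open>Ui\<close> and \<open>Uj\<close> whose
  product meets the projection trivially. The elements of \<open>\<Gamma>\<close> with these two
  coordinates in \<open>Ui \<times> Uj\<close> then lie in
  \<open>\<Gamma> \<inter> G\<^sub>k\<close>, and cocompactness of slices makes this discrete normal
  subgroup cocompact in \<open>G k\<close>, a contradiction.\<close>

lemma pair_proj_nondiscrete:
  assumes i: "i \<in> I" and j: "j \<in> I" and ij: "i \<noteq> j"
  shows "\<not> discrete_in (prod_topology (T i) (T j)) (pair_proj i j)"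
proof
  obtain k where k: "k \<in> I" "k \<noteq> i" "k \<noteq> j" "I = {i, j, k}"
    using third_index[OF i j ij] .
  interpret ij: tdlc_group_pair "G i" "T i" "G j" "T j"
    by (rule tdlc_pair[OF i j])
  interpret Gk: tdlc_group "G k" "T k"
    by (rule tdlc[OF k(1)])
  interpret kij: topological_group_pair "G k" "T k" "G i \<times>\<times> G j" "prod_topology (T i) (T j)"
    by unfold_locales
  assume "discrete_in (prod_topology (T i) (T j)) (pair_proj i j)"
  then obtain W where W: "openin (prod_topology (T i) (T j)) W" "\<one>\<^bsub>G i \<times>\<times> G j\<^esub> \<in> W"
    "W \<inter> pair_proj i j \<subseteq> {\<one>\<^bsub>G i \<times>\<times> G j\<^esub>}"
    using ij.XY.discrete_in_subgroup_iff[OF subgroup_pair_proj[OF i j]] by blast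
  obtain Wi Wj where Wij: "openin (T i) Wi" "openin (T j) Wj" "\<one>\<^bsub>G i\<^esub> \<in> Wi" "\<one>\<^bsub>G j\<^esub> \<in> Wj" "Wi \<times> Wj \<subseteq> W"
    using W(1,2) unfolding openin_prod_topology_alt one_DirProd by meson
  obtain Ui where Ui: "subgroup Ui (G i)" "openin (T i) Ui" "Ui \<subseteq> Wi"
    using ij.X.compact_open_subgroup[OF Wij(1,3)] .
  obtain Uj where Uj: "subgroup Uj (G j)" "openin (T j) Uj" "Uj \<subseteq> Wj"
    using ij.Y.compact_open_subgroup[OF Wij(2,4)] .
  have V: "subgroup (Ui \<times> Uj) (G i \<times>\<times> G j)"
    by (rule DirProd_subgroups[OF ij.X.group_axioms Ui(1) ij.Y.group_axioms Uj(1)])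
  have oV: "openin (prod_topology (T i) (T j)) (Ui \<times> Uj)"
    using Ui(2) Uj(2) by (simp add: openin_prod_Times_iff)
  \<comment> \<open>The three coordinates are regrouped as
    \<open>G k \<times> (G i \<times> G j)\<close>, so that slices in a product of two groups can be
    used.\<close>
  let ?f = "\<lambda>x. (x k, (x i, x j))"
  have H: "subgroup (?f ` \<Gamma>) (G k \<times>\<times> G i \<times>\<times> G j)"
    by (rule subgroup_hom_image[OF DirProd_group[OF Gk.group_axioms ij.XY.group_axioms]])
      (use i j k(1) in \<open>auto simp: hom_def\<close>)
  have cont: "continuous_map (product_topology T I) (prod_topology (T k) (prod_topology (T i) (T j))) ?f"
    by (intro continuous_map_pairedI continuous_map_product_projection i j k(1))
  obtain C where C: "compactin (product_topology T I) C"
    "\<And>x. x \<in> carrier (product_group I G) \<Longrightarrow> \<exists>h\<in>\<Gamma>. \<exists>c\<in>C. x = h \<otimes>\<^bsub>product_group I G\<^esub> c"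
    using compact_transversal by blast
  have C': "\<exists>h\<in>?f ` \<Gamma>. \<exists>c\<in>?f ` C. p = h \<otimes>\<^bsub>G k \<times>\<times> G i \<times>\<times> G j\<^esub> c"
    if p: "p \<in> carrier (G k \<times>\<times> G i \<times>\<times> G j)" for p
  proof -
    obtain a b c where abc: "p = (a, (b, c))" "a \<in> carrier (G k)" "b \<in> carrier (G i)" "c \<in> carrier (G j)"
      using p by auto
    have "(\<lambda>l\<in>I. if l = k then a else if l = i then b else c) \<in> carrier (product_group I G)"
      using abc k(4) by auto
    then obtain h d where hd: "h \<in> \<Gamma>" "d \<in> C"
      "(\<lambda>l\<in>I. if l = k then a else if l = i then b else c) = h \<otimes>\<^bsub>product_group I G\<^esub> d"
      using C(2) by blast
    have eq: "(\<lambda>l\<in>I. if l = k then a else if l = i then b else c) l = h l \<otimes>\<^bsub>G l\<^esub> d l" if "l \<in> I" for l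
      using that unfolding hd(3) by simp
    have "p = ?f h \<otimes>\<^bsub>G k \<times>\<times> G i \<times>\<times> G j\<^esub> ?f d"
      using eq[OF i] eq[OF j] eq[OF k(1)] i j k ij by (simp add: abc(1))
    then show ?thesis
      using hd(1,2) by blast
  qed
  obtain K where K: "compactin (T k) K"
    "\<And>x. x \<in> carrier (G k) \<Longrightarrow> \<exists>m\<in>slice (?f ` \<Gamma>) (Ui \<times> Uj). \<exists>y\<in>K. x = m \<otimes>\<^bsub>G k\<^esub> y"
    using kij.cocompact_slice[OF H V oV image_compactin[OF C(1) cont] C'] by blast
  have "slice (?f ` \<Gamma>) (Ui \<times> Uj) \<subseteq> axis k"
  proof
    fix m assume "m \<in> slice (?f ` \<Gamma>) (Ui \<times> Uj)"
    then obtain x where x: "x \<in> \<Gamma>" "m = x k" "(x i, x j) \<in> Ui \<times> Uj"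
      unfolding slice_def by auto
    have "(x i, x j) \<in> W \<inter> pair_proj i j"
      using x(1,3) Ui(3) Uj(3) Wij(5) unfolding pair_proj_def by blast
    then have "x i = \<one>\<^bsub>G i\<^esub>" "x j = \<one>\<^bsub>G j\<^esub>"
      using W(3) by auto
    then have "x l = \<one>\<^bsub>G l\<^esub>" if "l \<in> I" "l \<noteq> k" for l
      using that k(4) by auto
    moreover have "x \<in> (\<Pi>\<^sub>E i\<in>I. carrier (G i))"
      using subgroup.mem_carrier[OF \<Gamma>_subgroup x(1)] by simp
    ultimately have "embed k (x k) = x"
      by (auto simp: embed_def fun_eq_iff PiE_iff extensional_def)
    then show "m \<in> axis k"
      unfolding axis_def x(2) using x(1) \<Gamma>_carrier[OF x(1) k(1)] by simp
  qed
  then have K': "\<exists>m\<in>axis k. \<exists>y\<in>K. x = m \<otimes>\<^bsub>G k\<^esub> y" if "x \<in> carrier (G k)" for x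
    using K(2)[OF that] by blast
  show False
    using Gk.cocompact_normal_nondiscrete[OF qjnc[OF k(1)] cg[OF k(1)] nondiscrete[OF k(1)]
        normal_axis[OF k(1)] K(1) K'] discrete_axis[OF k(1)] by blast
qed

definition pair_closure :: "'i \<Rightarrow> 'i \<Rightarrow> ('a \<times> 'a) set" where
  "pair_closure i j = prod_topology (T i) (T j) closure_of pair_proj i j"

lemma pair_proj_subset_closure:
  assumes i: "i \<in> I" and j: "j \<in> I"
  shows "pair_proj i j \<subseteq> pair_closure i j"
proof -
  interpret ij: tdlc_group_pair "G i" "T i" "G j" "T j"
    by (rule tdlc_pair[OF i j])
  show ?thesis
    unfolding pair_closure_def
    by (rule closure_of_subset) (use subgroup.subset[OF subgroup_pair_proj[OF i j]] ij.XY.topspace_eq in simp)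
qed

lemma pair_closure_closed_subgroup:
  assumes i: "i \<in> I" and j: "j \<in> I"
  shows "subgroup (pair_closure i j) (G i \<times>\<times> G j)"
    and "closedin (prod_topology (T i) (T j)) (pair_closure i j)"
proof -
  interpret ij: tdlc_group_pair "G i" "T i" "G j" "T j"
    by (rule tdlc_pair[OF i j])
  show "subgroup (pair_closure i j) (G i \<times>\<times> G j)"
    unfolding pair_closure_def by (rule ij.XY.subgroup_closure_of[OF subgroup_pair_proj[OF i j]])
qed (simp add: pair_closure_def)

lemma pair_closure_swap:
  assumes "(a, b) \<in> pair_closure i j"
  shows "(b, a) \<in> pair_closure j i"
proof -
  let ?s = "\<lambda>p. (snd p, fst p)"
  have "continuous_map (prod_topology (T i) (T j)) (prod_topology (T j) (T i)) ?s"
    by (intro continuous_map_pairedI continuous_map_fst continuous_map_snd)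
  then have "?s ` pair_closure i j \<subseteq> prod_topology (T j) (T i) closure_of (?s ` pair_proj i j)"
    unfolding pair_closure_def by (rule continuous_map_image_closure_subset)
  moreover have "?s ` pair_proj i j = pair_proj j i"
    unfolding pair_proj_def by force
  ultimately show ?thesis
    unfolding pair_closure_def[of j i] using assms by force
qed

text \<open>The results on two factors apply: the closure contains the non-discrete projection of
  \<open>\<Gamma>\<close>, its projections to the factors contain those of \<open>\<Gamma>\<close>
  and are dense, and a compact transversal for \<open>\<Gamma>\<close> projects to one for the
  closure.\<close>

lemma slice_pair_closure:
  assumes i: "i \<in> I" and j: "j \<in> I" and ij: "i \<noteq> j"
  shows "slice (pair_closure i j) {\<one>\<^bsub>G j\<^esub>} \<lhd> G i"
    and "closedin (T i) (slice (pair_closure i j) {\<one>\<^bsub>G j\<^esub>})"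
    and "\<not> discrete_in (T i) (slice (pair_closure i j) {\<one>\<^bsub>G j\<^esub>})"
proof -
  interpret ij: tdlc_group_pair "G i" "T i" "G j" "T j"
    by (rule tdlc_pair[OF i j])
  note H = pair_closure_closed_subgroup[OF i j]
  have nd: "\<not> discrete_in (prod_topology (T i) (T j)) (pair_closure i j)"
    using pair_proj_nondiscrete[OF i j ij] ij.XY.discrete_in_subset pair_proj_subset_closure[OF i j] by blast
  have "(\<lambda>x. x i) ` \<Gamma> \<subseteq> fst ` pair_closure i j"
    using pair_proj_subset_closure[OF i j] unfolding pair_proj_def by force
  then have "carrier (G i) \<subseteq> T i closure_of (fst ` pair_closure i j)"
    using closure_of_mono dense[OF i] by metis
  then have d1: "T i closure_of (fst ` pair_closure i j) = carrier (G i)"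
    using closure_of_subset_topspace[of "T i"] ij.X.topspace_eq by blast
  have "(\<lambda>x. x j) ` \<Gamma> \<subseteq> snd ` pair_closure i j"
    using pair_proj_subset_closure[OF i j] unfolding pair_proj_def by force
  then have "carrier (G j) \<subseteq> T j closure_of (snd ` pair_closure i j)"
    using closure_of_mono dense[OF j] by metis
  then have d2: "T j closure_of (snd ` pair_closure i j) = carrier (G j)"
    using closure_of_subset_topspace[of "T j"] ij.Y.topspace_eq by blast
  show "slice (pair_closure i j) {\<one>\<^bsub>G j\<^esub>} \<lhd> G i" "closedin (T i) (slice (pair_closure i j) {\<one>\<^bsub>G j\<^esub>})"
    by (rule ij.slice_one_normal[OF H d1])+
  let ?f = "\<lambda>x. (x i, x j)"
  have cont: "continuous_map (product_topology T I) (prod_topology (T i) (T j)) ?f"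
    by (intro continuous_map_pairedI continuous_map_product_projection i j)
  obtain C where C: "compactin (product_topology T I) C"
    "\<And>x. x \<in> carrier (product_group I G) \<Longrightarrow> \<exists>h\<in>\<Gamma>. \<exists>c\<in>C. x = h \<otimes>\<^bsub>product_group I G\<^esub> c"
    using compact_transversal by blast
  have C': "\<exists>h\<in>pair_closure i j. \<exists>c\<in>?f ` C. p = h \<otimes>\<^bsub>G i \<times>\<times> G j\<^esub> c"
    if p: "p \<in> carrier (G i \<times>\<times> G j)" for p
  proof -
    obtain a b where ab: "p = (a, b)" "a \<in> carrier (G i)" "b \<in> carrier (G j)"
      using p by auto
    \<comment> \<open>Filling the third coordinate with the identity lifts \<open>p\<close> to the
      full product.\<close>
    define x where "x = (\<lambda>l\<in>I. if l = i then a else if l = j then b else \<one>\<^bsub>G l\<^esub>)"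
    have "x \<in> carrier (product_group I G)"
      unfolding x_def using ab monoid.one_closed[OF group.is_monoid[OF group]] by auto
    then obtain h d where hd: "h \<in> \<Gamma>" "d \<in> C" "x = h \<otimes>\<^bsub>product_group I G\<^esub> d"
      using C(2) by blast
    have eq: "x l = h l \<otimes>\<^bsub>G l\<^esub> d l" if "l \<in> I" for l
      using that unfolding hd(3) by simp
    have "p = ?f h \<otimes>\<^bsub>G i \<times>\<times> G j\<^esub> ?f d"
      using eq[OF i] eq[OF j] i j ij by (simp add: ab(1) x_def)
    moreover have "?f h \<in> pair_closure i j"
      using pair_proj_subset_closure[OF i j] hd(1) unfolding pair_proj_def by blast
    ultimately show ?thesis
      using hd(2) by blast
  qed
  show "\<not> discrete_in (T i) (slice (pair_closure i j) {\<one>\<^bsub>G j\<^esub>})"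
    by (rule ij.slice_one_nondiscrete[OF qjnc[OF i] qjnc[OF j] cg[OF i] nondiscrete[OF i] H nd d1 d2
          image_compactin[OF C(1) cont] C'])
qed

subsubsection \<open>Irreducibility\<close>

lemma proper_subset_cases:
  assumes "\<Sigma> \<subset> I"
  obtains "\<Sigma> = {}" | i where "i \<in> I" "\<Sigma> = {i}" | i j where "i \<in> I" "j \<in> I" "i \<noteq> j" "\<Sigma> = {i, j}"
proof -
  have "card \<Sigma> < 3"
    using psubset_card_mono[OF finite_I assms] card_I by simp
  then consider "card \<Sigma> = 0" | "card \<Sigma> = 1" | "card \<Sigma> = 2"
    by linarith
  then show ?thesis
  proof cases
    case 1
    then show ?thesis
      using that(1) assms finite_subset[OF _ finite_I] by auto
  next
    case 2
    then show ?thesis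
      using that(2) assms by (metis card_1_singletonE insert_subset psubset_imp_subset)
  next
    case 3
    then obtain i j where "\<Sigma> = {i, j}" "i \<noteq> j"
      unfolding card_2_iff by blast
    then show ?thesis
      using that(3) assms by blast
  qed
qed

lemma continuous_map_single: "continuous_map (T i) (product_topology T {i}) (\<lambda>a. \<lambda>l\<in>{i}. a)"
  by (auto simp: continuous_map_componentwise)

lemma continuous_map_pair:
  "i \<noteq> j \<Longrightarrow> continuous_map (prod_topology (T i) (T j)) (product_topology T {i, j})
    (\<lambda>p. \<lambda>l\<in>{i, j}. if l = i then fst p else snd p)"
  using continuous_map_fst continuous_map_snd by (auto simp: continuous_map_componentwise)

lemma proj_single_eq: "(\<lambda>a. \<lambda>l\<in>{i}. a) ` (\<lambda>x. x i) ` \<Gamma> = proj {i} ` \<Gamma>"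
  unfolding image_image by (intro image_cong) auto

lemma proj_pair_eq: "(\<lambda>p. \<lambda>l\<in>{i, j}. if l = i then fst p else snd p) ` pair_proj i j = proj {i, j} ` \<Gamma>"
  unfolding pair_proj_def image_image by (intro image_cong) auto

text \<open>Discreteness is pulled back from functions on \<open>\<Sigma>\<close> to single
  coordinates or pairs along injective continuous maps, where the results for one and two factors
  exclude it.\<close>

lemma Irr3: "Irr3 I T \<Gamma>"
  unfolding Irr3_def
proof (intro allI impI, elim conjE)
  fix \<Sigma> assume ne: "\<Sigma> \<noteq> {}" and "\<Sigma> \<subset> I"
  from \<open>\<Sigma> \<subset> I\<close> show "\<not> discrete_in (product_topology T \<Sigma>) (proj \<Sigma> ` \<Gamma>)"
  proof (cases rule: proper_subset_cases)
    case 1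
    then show ?thesis
      using ne by simp
  next
    case (2 i)
    show ?thesis
    proof
      assume "discrete_in (product_topology T \<Sigma>) (proj \<Sigma> ` \<Gamma>)"
      then have "discrete_in (product_topology T {i}) (proj {i} ` \<Gamma>)"
        using 2 by simp
      moreover have "(\<lambda>x. x i) ` \<Gamma> \<subseteq> topspace (T i)"
        using \<Gamma>_carrier 2 topological_group.topspace_eq[OF topological_group[OF 2(1)]] by auto
      moreover have "inj_on (\<lambda>a. \<lambda>l\<in>{i}. a) ((\<lambda>x. x i) ` \<Gamma>)"
      proof (rule inj_onI)
        fix a b :: 'a
        assume "(\<lambda>l\<in>{i}. a) = (\<lambda>l\<in>{i}. b)"
        from fun_cong[OF this, of i] show "a = b"
          by simp
      qed
      ultimately have "discrete_in (T i) ((\<lambda>x. x i) ` \<Gamma>)"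
        by (rule discrete_in_vimage[OF _ continuous_map_single _ _ eq_refl[OF proj_single_eq]])
      then show False
        using proj1_nondiscrete[OF 2(1)] by contradiction
    qed
  next
    case (3 i j)
    show ?thesis
    proof
      assume "discrete_in (product_topology T \<Sigma>) (proj \<Sigma> ` \<Gamma>)"
      then have "discrete_in (product_topology T {i, j}) (proj {i, j} ` \<Gamma>)"
        using 3 by simp
      moreover have "pair_proj i j \<subseteq> topspace (prod_topology (T i) (T j))"
        by (rule subset_trans[OF pair_proj_subset_closure[OF 3(1,2), unfolded pair_closure_def]
              closure_of_subset_topspace])
      moreover have "inj_on (\<lambda>p. \<lambda>l\<in>{i, j}. if l = i then fst p else snd p) (pair_proj i j)"
      proof (rule inj_onI)
        fix p q :: "'a \<times> 'a"
        assume "(\<lambda>l\<in>{i, j}. if l = i then fst p else snd p) = (\<lambda>l\<in>{i, j}. if l = i then fst q else snd q)"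
        from fun_cong[OF this, of i] fun_cong[OF this, of j] show "p = q"
          using 3(3) by (simp add: prod_eq_iff)
      qed
      ultimately have "discrete_in (prod_topology (T i) (T j)) (pair_proj i j)"
        by (rule discrete_in_vimage[OF _ continuous_map_pair[OF 3(3)] _ _ eq_refl[OF proj_pair_eq]])
      then show False
        using pair_proj_nondiscrete[OF 3(1-3)] by contradiction
    qed
  qed
qed

section \<open>The subgroups \<open>G\<^sub>i\<^sup>+\<close> and (Irr1')\<close>

text \<open>The intersection runs over all \<open>j\<close> other than \<open>i\<close>, so that one
  choice serves every \<open>\<Sigma>\<close>.\<close>

definition plus_part :: "'i \<Rightarrow> 'a set" where
  "plus_part i = (\<Inter>j\<in>I - {i}. slice (pair_closure i j) {\<one>\<^bsub>G j\<^esub>})"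

text \<open>Non-discreteness comes first: \<open>A\<close> is cocompact and \<open>B\<close>
  non-discrete, so \<open>A \<inter> B\<close> is non-discrete. Quasi just-non-compactness then
  gives cocompactness.\<close>

lemma plus_part:
  assumes i: "i \<in> I"
  shows "plus_part i \<lhd> G i" "closedin (T i) (plus_part i)" "cocompact (G i) (T i) (plus_part i)"
    "\<not> discrete_in (T i) (plus_part i)"
proof -
  interpret tdlc_group "G i" "T i"
    by (rule tdlc[OF i])
  obtain j where j: "j \<in> I" "i \<noteq> j"
    using card_I i by (metis card_1_singleton_iff card_3_iff insertCI)
  obtain k where k: "k \<in> I" "k \<noteq> i" "k \<noteq> j" "I = {i, j, k}"
    using third_index[OF i j] .
  define A where "A = slice (pair_closure i j) {\<one>\<^bsub>G j\<^esub>}"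
  define B where "B = slice (pair_closure i k) {\<one>\<^bsub>G k\<^esub>}"
  have eq: "plus_part i = A \<inter> B"
    unfolding plus_part_def A_def B_def using j k by auto
  note A = slice_pair_closure[OF i j, folded A_def]
  note B = slice_pair_closure[OF i k(1) k(2)[symmetric], folded B_def]
  have "cocompact (G i) (T i) A"
    using qjnc[OF i] A unfolding quasi_just_non_compact_def by blast
  then obtain K where K: "compactin (T i) K"
    "\<And>g. g \<in> carrier (G i) \<Longrightarrow> \<exists>h\<in>A. \<exists>k\<in>K. g = h \<otimes>\<^bsub>G i\<^esub> k"
    using cocompact_imp_compact_transversal[OF locally_compact normal_imp_subgroup[OF A(1)]] by blast
  show nd: "\<not> discrete_in (T i) (plus_part i)"
    unfolding eq using cocompact_Int_nondiscrete[OF qjnc[OF i] cg[OF i] A(1) K B] by blast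
  show n: "plus_part i \<lhd> G i"
    unfolding eq by (rule normal_subgroup_intersect[OF A(1) B(1)])
  show c: "closedin (T i) (plus_part i)"
    unfolding eq using A(2) B(2) by blast
  show "cocompact (G i) (T i) (plus_part i)"
    using qjnc[OF i] n c nd unfolding quasi_just_non_compact_def by blast
qed

lemma Irr1': "Irr1' I G T \<Gamma>"
  unfolding Irr1'_def
proof (intro exI[of _ plus_part] conjI ballI allI impI)
  fix \<Sigma> assume "\<Sigma> \<subset> I"
  then show "PiE \<Sigma> plus_part \<subseteq> product_topology T \<Sigma> closure_of (proj \<Sigma> ` \<Gamma>)"
  proof (cases rule: proper_subset_cases)
    case 1
    \<comment> \<open>The empty product has one point, the function that is \<open>undefined\<close>
      everywhere; it is attained because \<open>\<Gamma>\<close> is non-empty.\<close>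
    have "proj \<Sigma> ` \<Gamma> = {\<lambda>_. undefined}"
      using \<Gamma>_one unfolding 1 by (auto simp: restrict_def)
    then have "{\<lambda>_. undefined} \<subseteq> product_topology T \<Sigma> closure_of (proj \<Sigma> ` \<Gamma>)"
      using closure_of_subset[of "{\<lambda>_. undefined}" "product_topology T \<Sigma>"] 1 by simp
    then show ?thesis
      using 1 by simp
  next
    case (2 i)
    show ?thesis
      unfolding 2(2)
    proof
      fix f assume f: "f \<in> PiE {i} plus_part"
      \<comment> \<open>For one factor, density of the projection already gives the whole
        group.\<close>
      then have "f i \<in> carrier (G i)"
        using subgroup.mem_carrier[OF normal_imp_subgroup[OF plus_part(1)[OF 2(1)]]] by auto
      then have "f i \<in> T i closure_of ((\<lambda>x. x i) ` \<Gamma>)"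
        using dense[OF 2(1)] by simp
      then have "(\<lambda>l\<in>{i}. f i) \<in> product_topology T {i} closure_of (proj {i} ` \<Gamma>)"
        using continuous_map_image_closure_subset[OF continuous_map_single, of i "(\<lambda>x. x i) ` \<Gamma>"]
        unfolding proj_single_eq by blast
      moreover have "(\<lambda>l\<in>{i}. f i) = f"
        using f by (auto simp: PiE_iff extensional_def fun_eq_iff)
      ultimately show "f \<in> product_topology T {i} closure_of (proj {i} ` \<Gamma>)"
        by simp
    qed
  next
    case (3 i j)
    note H = pair_closure_closed_subgroup(1)[OF 3(1,2)]
    interpret ij: tdlc_group_pair "G i" "T i" "G j" "T j"
      by (rule tdlc_pair[OF 3(1,2)])
    show ?thesis
      unfolding 3(4)
    proof
      fix f assume f: "f \<in> PiE {i, j} plus_part"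
      have plusD: "(a, \<one>\<^bsub>G m\<^esub>) \<in> pair_closure l m" if "a \<in> plus_part l" "m \<in> I" "m \<noteq> l" for a l m
        using that by (simp add: plus_part_def slice_def)
      have "f i \<in> plus_part i" "f j \<in> plus_part j"
        using f by auto
      from plusD[OF this(1) 3(2)] plusD[OF this(2) 3(1)]
      have 1: "(f i, \<one>\<^bsub>G j\<^esub>) \<in> pair_closure i j" and 2: "(\<one>\<^bsub>G i\<^esub>, f j) \<in> pair_closure i j"
        using 3(3) by (simp_all add: pair_closure_swap)
      \<comment> \<open>The closure is a group, so it contains the product of
        \<open>(f i, 1)\<close> and \<open>(1, f j)\<close>; the latter comes from the closure for
        \<open>j\<close> and \<open>i\<close> by exchanging the factors.\<close>
      have "(f i \<otimes>\<^bsub>G i\<^esub> \<one>\<^bsub>G i\<^esub>, \<one>\<^bsub>G j\<^esub> \<otimes>\<^bsub>G j\<^esub> f j) \<in> pair_closure i j"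
        by (rule ij.DirProd_subgroupD(4)[OF H 1 2])
      then have "(f i, f j) \<in> pair_closure i j"
        using ij.DirProd_subgroupD(1)[OF H 1] ij.DirProd_subgroupD(2)[OF H 2] by simp
      then have "(\<lambda>l\<in>{i, j}. if l = i then fst (f i, f j) else snd (f i, f j))
          \<in> product_topology T {i, j} closure_of (proj {i, j} ` \<Gamma>)"
        using continuous_map_image_closure_subset[OF continuous_map_pair[OF 3(3)], of "pair_proj i j"]
        unfolding proj_pair_eq pair_closure_def by blast
      moreover have "(\<lambda>l\<in>{i, j}. if l = i then fst (f i, f j) else snd (f i, f j)) = f"
        using f by (auto simp: PiE_iff extensional_def fun_eq_iff)
      ultimately show "f \<in> product_topology T {i, j} closure_of (proj {i, j} ` \<Gamma>)"
        by simp
    qed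
  qed
qed (use plus_part in auto)

end

theorem corollary9:
  fixes G :: "nat \<Rightarrow> 'a monoid" and T :: "nat \<Rightarrow> 'a topology"
    and \<Gamma> :: "(nat \<Rightarrow> 'a) set"
  assumes "\<And>i. i \<in> {1, 2, 3} \<Longrightarrow> tdlc_group (G i) (T i)"
    and "\<And>i. i \<in> {1, 2, 3} \<Longrightarrow> \<not> discrete_in (T i) (carrier (G i))"
    and "\<And>i. i \<in> {1, 2, 3} \<Longrightarrow> compactly_generated (G i) (T i)"
    and "\<And>i. i \<in> {1, 2, 3} \<Longrightarrow> quasi_just_non_compact (G i) (T i)"
    and "cocompact_lattice (product_group {1, 2, 3} G) (product_topology T {1, 2, 3}) \<Gamma>"
    and "\<And>i. i \<in> {1, 2, 3} \<Longrightarrow> T i closure_of ((\<lambda>x. x i) ` \<Gamma>) = carrier (G i)"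
  shows "Irr0 {1, 2, 3} G \<Gamma> \<and> Irr1' {1, 2, 3} G T \<Gamma> \<and> Irr3 {1, 2, 3} T \<Gamma>"
proof -
  interpret product_lattice "{1, 2, 3}" G T \<Gamma>
    by (rule product_lattice.intro[OF _ assms]) simp_all
  show ?thesis
    using Irr0 Irr1' Irr3 by blast
qed

end
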